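(* Let $p\ne1/2$ and $c(p)=\big|\log\frac{1-p}{p}\big|^{-1}$. For every $\epsilon>0$, as $t\to\infty$, $$\mathbb{P}_p\Big((1-\epsilon)c(p)\log t\le\max_{s\in(0,t)}M_s\le\max_{s\in(0,t)}D_s\le(1+\epsilon)c(p)\log t\ \Big|\ X_t=O\Big)\to1.$$
   Context: The simple exclusion process on $\mathbb{Z}$ with parameter $p\in(0,1)$: each site is occupied by at most one particle; each particle attempts to jump one site to the right at rate $p$ and one site to the left at rate $1-p$, an attempt succeeding iff the target site is empty. $O$ is the configuration with every negative site occupied and every non-negative site empty. $\mathbb{P}_p$ is the law of the process started from $O$, $X_t$ the state at time $t$. For a configuration $x$ reachable from $O$, $D(x)$ is the minimal number of jumps needed to go from $O$ to $x$ (equivalently the sum over $k\ge1$ of the displacement of the $k$-th rightmost particle from its initial position $-k$), and $M(x)$ is the position of the rightmost particle of $x$. $D_t=D(X_t)$, $M_t=M(X_t)$. *)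

theory Defs
  imports "HOL-Analysis.Analysis"
begin

text \<open>Configurations of the exclusion process on the integers: the set of occupied sites.\<close>
type_synonym config = "int set"

definition O_conf :: config where
  "O_conf = {k. k < 0}"

definition right_jump :: "config \<Rightarrow> config \<Rightarrow> bool" where
  "right_jump x y \<longleftrightarrow> (\<exists>i. i \<in> x \<and> i + 1 \<notin> x \<and> y = insert (i + 1) (x - {i}))"

definition left_jump :: "config \<Rightarrow> config \<Rightarrow> bool" where
  "left_jump x y \<longleftrightarrow> (\<exists>i. i \<in> x \<and> i - 1 \<notin> x \<and> y = insert (i - 1) (x - {i}))"

definition rate :: "real \<Rightarrow> config \<Rightarrow> config \<Rightarrow> real" where
  "rate p x y = (if right_jump x y then p else 0) + (if left_jump x y then 1 - p else 0)"

text \<open>Total jump rate out of x (finite for configurations reachable from O).\<close>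
definition qrate :: "real \<Rightarrow> config \<Rightarrow> real" where
  "qrate p x = p * real (card {i. i \<in> x \<and> i + 1 \<notin> x})
             + (1 - p) * real (card {i. i \<in> x \<and> i - 1 \<notin> x})"

text \<open>path_prob p xs t: probability (for the continuous-time Markov chain started at hd xs)
  that the sequence of states visited up to time t is exactly xs, i.e. the chain makes
  exactly length xs - 1 jumps in [0,t], through the states of xs in order.
  First-jump decomposition: the chain stays at x for an Exp(q(x)) time s, then jumps to y
  with probability rate(x,y)/q(x).\<close>
fun path_prob :: "real \<Rightarrow> config list \<Rightarrow> real \<Rightarrow> real" where
  "path_prob p [] t = 0"
| "path_prob p [x] t = exp (- qrate p x * t)"
| "path_prob p (x # y # r) t =
     (LINT s:{0..t}|lborel. exp (- qrate p x * s) * rate p x y * path_prob p (y # r) (t - s))"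

definition paths_O_O :: "config list set" where
  "paths_O_O = {xs. xs \<noteq> [] \<and> hd xs = O_conf \<and> last xs = O_conf \<and>
      (\<forall>i. Suc i < length xs \<longrightarrow> right_jump (xs ! i) (xs ! Suc i) \<or> left_jump (xs ! i) (xs ! Suc i))}"

definition kth_pos :: "config \<Rightarrow> nat \<Rightarrow> int" where
  "kth_pos x k = (THE i. i \<in> x \<and> card {j \<in> x. j > i} = k - 1)"

text \<open>D(x): sum over k \<ge> 1 of the displacement of the k-th rightmost particle from -k
  (only finitely many terms are nonzero for configurations reachable from O).\<close>
definition Dist :: "config \<Rightarrow> int" where
  "Dist x = (\<Sum>k \<in> {k. k \<ge> 1 \<and> kth_pos x k \<noteq> - int k}. kth_pos x k + int k)"

definition Mpos :: "config \<Rightarrow> int" where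
  "Mpos x = (GREATEST i. i \<in> x)"

text \<open>Conditional probability given X_t = O, written as a ratio of sums over jump paths.
  Since a.s. the chain has finitely many jumps in [0,t] and every holding time is positive,
  the set of states visited during (0,t) is exactly the set of states of the jump path.\<close>
definition cond_prob_O :: "real \<Rightarrow> (config list \<Rightarrow> bool) \<Rightarrow> real \<Rightarrow> real" where
  "cond_prob_O p E t =
     (\<Sum>\<^sub>\<infinity>xs \<in> {xs \<in> paths_O_O. E xs}. path_prob p xs t) / (\<Sum>\<^sub>\<infinity>xs \<in> paths_O_O. path_prob p xs t)"

end

theory Submission
  imports Defs "HOL-Real_Asymp.Real_Asymp"
begin

text \<open>
  A reachable configuration always admits exactly one more right jump than left jumps, so the
  weight of a path from \<open>O\<close> to \<open>O\<close> depends on \<open>p\<close> only through \<open>p (1 - p)\<close> and a factor common to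
  all paths. Hence the conditioned law is invariant under \<open>p \<mapsto> 1 - p\<close> and one may take \<open>p < 1/2\<close>,
  where the chain is reversible with summable weight \<open>r\<^sup>D\<close>, \<open>r = p / (1 - p)\<close>.

  Stationarity bounds the probability of leaving \<open>{D \<le> N}\<close> before time \<open>t\<close> by \<open>t\<close> times the flux
  through the boundary, which is \<open>r\<^sup>N\<close> up to a subexponential factor because
  \<open>\<Sum>\<^sub>x r'\<^sup>D\<^sup>(\<^sup>x\<^sup>)\<close> is finite for every \<open>r' < 1\<close>. The rightmost particle dominates a reflected random
  walk, whose expected time to reach level \<open>L\<close> is of order \<open>r\<^sup>-\<^sup>L\<close>; the hitting-time function is a
  supersolution showing that \<open>M\<close> stays below \<open>L\<close> up to time \<open>t\<close> with probability at most
  \<open>exp (- t / hitting time)\<close>. Finally \<open>P(X\<^sub>t = O)\<close> is bounded below by reversibility and the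
  Cauchy--Schwarz inequality. All estimates are comparisons for the backward equation, applied to
  the sums over paths with a bounded number of jumps.
\<close>

section \<open>Reachable configurations\<close>

inductive reachable :: "config \<Rightarrow> bool" where
  reachable_O: "reachable O_conf"
| reachable_right: "reachable x \<Longrightarrow> right_jump x y \<Longrightarrow> reachable y"
| reachable_left: "reachable x \<Longrightarrow> left_jump x y \<Longrightarrow> reachable y"

definition defects :: "config \<Rightarrow> int set" where
  "defects x = {i. (i \<in> x) \<noteq> (i < 0)}"

text \<open>The distance D computed from sites instead of labelled particles: the displacements add
  up to the positions of the particles at nonnegative sites minus those of the holes at negative
  sites (\<open>Dist_eq_energy\<close>). In this form powers \<open>r ^ energy x\<close> factor over
  sites.\<close>

definition energy :: "config \<Rightarrow> nat" where
  "energy x = (\<Sum>i\<in>defects x. nat \<bar>i\<bar>)"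

definition right_sites :: "config \<Rightarrow> int set" where
  "right_sites x = {i. i \<in> x \<and> i + 1 \<notin> x}"

definition left_sites :: "config \<Rightarrow> int set" where
  "left_sites x = {i. i \<in> x \<and> i - 1 \<notin> x}"

definition right_nbs :: "config \<Rightarrow> config set" where
  "right_nbs x = {y. right_jump x y}"

definition left_nbs :: "config \<Rightarrow> config set" where
  "left_nbs x = {y. left_jump x y}"

definition nbs :: "config \<Rightarrow> config set" where
  "nbs x = {y. right_jump x y \<or> left_jump x y}"

abbreviation move :: "config \<Rightarrow> int \<Rightarrow> int \<Rightarrow> config" where
  "move x i d \<equiv> insert (i + d) (x - {i})"

lemma right_jump_iff_left_jump: "right_jump x y \<longleftrightarrow> left_jump y x"
proof
  assume "right_jump x y"
  then obtain i where "i \<in> x" "i + 1 \<notin> x" "y = move x i 1" by (auto simp: right_jump_def)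
  then show "left_jump y x" unfolding left_jump_def by (intro exI[of _ "i+1"]) auto
next
  assume "left_jump y x"
  then obtain i where "i \<in> y" "i - 1 \<notin> y" "x = insert (i - 1) (y - {i})"
    by (auto simp: left_jump_def)
  then show "right_jump x y" unfolding right_jump_def by (intro exI[of _ "i-1"]) auto
qed

lemma finite_defects_move:
  assumes "finite (defects x)" shows "finite (defects (move x i d))"
proof -
  have "defects (move x i d) \<subseteq> defects x \<union> {i, i + d}" by (auto simp: defects_def)
  then show ?thesis using assms by (meson finite.intros finite_UnI finite_subset)
qed

text \<open>At a defect \<open>i\<close> the bracket is 1 for \<open>i \<ge> 0\<close> and -1 for
  \<open>i < 0\<close>, so each term is an absolute value. The window \<open>I\<close> can be shared
  by two configurations, whose energies are then subtracted term by term.\<close>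

lemma energy_eq_signed_sum:
  assumes "finite I" "defects x \<subseteq> I"
  shows "int (energy x) = (\<Sum>i\<in>I. i * (of_bool (i \<in> x) - of_bool (i < 0)))"
proof -
  have "int (energy x) = (\<Sum>i\<in>defects x. i * (of_bool (i \<in> x) - of_bool (i < 0)))"
    unfolding energy_def of_nat_sum by (rule sum.cong) (auto simp: defects_def of_bool_def)
  also have "\<dots> = (\<Sum>i\<in>I. i * (of_bool (i \<in> x) - of_bool (i < 0)))"
    by (rule sum.mono_neutral_left) (use assms in \<open>auto simp: defects_def\<close>)
  finally show ?thesis .
qed

lemma energy_move:
  assumes "finite (defects x)" "i \<in> x" "i + d \<notin> x"
  shows "int (energy (move x i d)) = int (energy x) + d"
proof -
  define y where "y = move x i d"
  define I where "I = defects x \<union> {i, i + d}"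
  have I: "finite I" "defects x \<subseteq> I" "defects y \<subseteq> I" "i \<in> I" "i + d \<in> I"
    using assms by (auto simp: I_def y_def defects_def)
  have "i \<noteq> i + d" using assms by metis
  have "int (energy y) - int (energy x) = (\<Sum>j\<in>I. j * (of_bool (j \<in> y) - of_bool (j \<in> x)))"
    unfolding energy_eq_signed_sum[OF I(1,2)] energy_eq_signed_sum[OF I(1,3)]
      sum_subtractf[symmetric] by (rule sum.cong) (auto simp: algebra_simps)
  also have "\<dots> = (\<Sum>j\<in>{i, i + d}. j * (of_bool (j \<in> y) - of_bool (j \<in> x)))"
    by (rule sum.mono_neutral_right) (use I in \<open>auto simp: y_def\<close>)
  also have "\<dots> = d" using \<open>i \<noteq> i + d\<close> assms by (auto simp: y_def)
  finally show ?thesis by (simp add: y_def)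
qed

lemma defects_O [simp]: "defects O_conf = {}" and energy_O [simp]: "energy O_conf = 0"
  by (auto simp: defects_def O_conf_def energy_def)

lemma reachable_finite_defects: "reachable x \<Longrightarrow> finite (defects x)"
proof (induction rule: reachable.induct)
  case (reachable_left x y)
  then obtain i where "y = move x i (-1)" by (auto simp: left_jump_def)
  then show ?case using reachable_left finite_defects_move by blast
next
  case (reachable_right x y)
  then obtain i where "y = move x i 1" by (auto simp: right_jump_def)
  then show ?case using reachable_right finite_defects_move by blast
qed auto

lemma energy_right_jump: "reachable x \<Longrightarrow> right_jump x y \<Longrightarrow> energy y = energy x + 1"
  using energy_move[OF reachable_finite_defects] by (force simp: right_jump_def)

lemma energy_left_jump: "reachable x \<Longrightarrow> left_jump x y \<Longrightarrow> energy x = energy y + 1"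
  by (meson energy_right_jump reachable_left right_jump_iff_left_jump)

lemma reachable_nbs: "reachable x \<Longrightarrow> y \<in> nbs x \<Longrightarrow> reachable y"
  by (auto simp: nbs_def intro: reachable_right reachable_left)

lemma nbs_sym: "y \<in> nbs x \<longleftrightarrow> x \<in> nbs y"
  by (auto simp: nbs_def right_jump_iff_left_jump)

lemma rate_nonneg: "0 \<le> p \<Longrightarrow> p \<le> 1 \<Longrightarrow> 0 \<le> rate p x y"
  by (simp add: rate_def)

lemma rate_eq_0: "y \<notin> nbs x \<Longrightarrow> rate p x y = 0"
  by (simp add: rate_def nbs_def)

text \<open>A right jump raises the energy and a left jump lowers it, so no pair of configurations
  admits both and a single summand of \<open>rate\<close> survives.\<close>

lemma rate_right: "reachable x \<Longrightarrow> right_jump x y \<Longrightarrow> rate p x y = p"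
  using energy_right_jump energy_left_jump by (force simp: rate_def)

lemma rate_left: "reachable x \<Longrightarrow> left_jump x y \<Longrightarrow> rate p x y = 1 - p"
  using energy_right_jump energy_left_jump by (force simp: rate_def)

section \<open>Counting the possible jumps\<close>

lemma defects_subset_energy:
  assumes "finite (defects x)"
  shows "defects x \<subseteq> {- int (energy x)..int (energy x)}"
proof
  fix i assume "i \<in> defects x"
  then have "nat \<bar>i\<bar> \<le> energy x"
    unfolding energy_def using assms by (intro member_le_sum) auto
  then show "i \<in> {- int (energy x)..int (energy x)}" by auto
qed

text \<open>Occupation is 1 far to the left and 0 far to the right, so its decrements telescope to
  1. Positive decrements are the right sites; negative ones are the left sites shifted by
  one.\<close>

lemma card_right_sites:
  assumes "reachable x"
  shows "finite (right_sites x)" "finite (left_sites x)"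
    "card (right_sites x) = card (left_sites x) + 1"
    "card (right_sites x) \<le> 2 * energy x + 2"
proof -
  define K where "K = int (energy x)"
  have K: "defects x \<subseteq> {-K..K}" "K \<ge> 0"
    using defects_subset_energy[OF reachable_finite_defects[OF assms]] by (auto simp: K_def)
  then have in_x: "j \<in> x \<longleftrightarrow> j < 0" if "j < - K \<or> j > K" for j
    using that by (auto simp: defects_def)
  have lo: "j \<in> x" if "j < -K" for j using in_x[of j] that K by auto
  have hi: "j \<notin> x" if "j > K" for j using in_x[of j] that K by auto
  \<comment> \<open>The window includes -K-1, which is always occupied and is a right site when -K
    is empty.\<close>
  define J where "J = {-K-1..K}"
  define S where "S = {i. i \<notin> x \<and> i + 1 \<in> x}"
  have RJ: "right_sites x \<subseteq> J"
    using lo hi unfolding right_sites_def J_def by (smt (verit) atLeastAtMost_iff mem_Collect_eq subsetI)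
  have SJ: "S \<subseteq> J"
    using lo hi unfolding S_def J_def by (smt (verit) atLeastAtMost_iff mem_Collect_eq subsetI)
  have J: "finite J" by (simp add: J_def)
  show fin: "finite (right_sites x)" using RJ J finite_subset by blast
  have LS: "left_sites x = (\<lambda>i. i + 1) ` S"
    by (force simp: left_sites_def S_def image_iff algebra_simps)
  have finS: "finite S" using SJ J finite_subset by blast
  then show "finite (left_sites x)" by (simp add: LS)
  have "card (left_sites x) = card S" unfolding LS by (rule card_image) simp
  have telescope: "(\<Sum>i\<in>{-K-1..-K-1 + int n}. (of_bool (i \<in> x) - of_bool (i + 1 \<in> x) :: int))
      = of_bool (-K-1 \<in> x) - of_bool (-K + int n \<in> x)" for n
  proof (induction n)
    case (Suc n)
    have "{-K-1..-K-1 + int (Suc n)} = insert (-K + int n) {-K-1..-K-1 + int n}" by auto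
    then show ?case using Suc by (simp add: algebra_simps)
  qed simp
  have "int (card (right_sites x)) - int (card S)
      = (\<Sum>i\<in>J. of_bool (i \<in> right_sites x)) - (\<Sum>i\<in>J. of_bool (i \<in> S))"
    using J RJ SJ by (simp add: Int_absorb1 Int_absorb2 sum.If_cases of_bool_def)
  also have "\<dots> = (\<Sum>i\<in>J. (of_bool (i \<in> x) - of_bool (i + 1 \<in> x) :: int))"
    unfolding sum_subtractf[symmetric]
    by (rule sum.cong) (auto simp: right_sites_def S_def)
  also have "\<dots> = of_bool (-K-1 \<in> x) - of_bool (K + 1 \<in> x)"
    using telescope[of "nat (2*K+1)"] K(2) by (simp add: J_def algebra_simps)
  also have "\<dots> = 1" using lo[of "-K-1"] hi[of "K+1"] by simp
  finally show "card (right_sites x) = card (left_sites x) + 1"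
    using \<open>card (left_sites x) = card S\<close> by simp
  have "card (right_sites x) \<le> card J" by (rule card_mono[OF J RJ])
  then show "card (right_sites x) \<le> 2 * energy x + 2" by (simp add: J_def K_def)
qed

lemma right_nbs_eq: "right_nbs x = (\<lambda>i. move x i 1) ` right_sites x"
  by (auto simp: right_nbs_def right_jump_def right_sites_def)

lemma left_nbs_eq: "left_nbs x = (\<lambda>i. move x i (-1)) ` left_sites x"
  by (auto simp: left_nbs_def left_jump_def left_sites_def)

lemma inj_on_move_right: "inj_on (\<lambda>i. move x i 1) (right_sites x)"
proof (rule inj_onI)
  fix i j assume *: "i \<in> right_sites x" "j \<in> right_sites x" "move x i 1 = move x j 1"
  have "i \<notin> move x i 1" by simp
  then have "i \<notin> move x j 1" using * by metis
  then show "i = j" using * by (auto simp: right_sites_def)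
qed

lemma inj_on_move_left: "inj_on (\<lambda>i. move x i (-1)) (left_sites x)"
proof (rule inj_onI)
  fix i j assume *: "i \<in> left_sites x" "j \<in> left_sites x" "move x i (-1) = move x j (-1)"
  have "i \<notin> move x i (-1)" by simp
  then have "i \<notin> move x j (-1)" using * by metis
  then show "i = j" using * by (auto simp: left_sites_def)
qed

lemma finite_nbs:
  assumes "reachable x" shows "finite (nbs x)"
proof -
  have "nbs x = right_nbs x \<union> left_nbs x" by (auto simp: nbs_def right_nbs_def left_nbs_def)
  then show ?thesis using card_right_sites[OF assms] by (simp add: right_nbs_eq left_nbs_eq)
qed

text \<open>Right and left neighbours are disjoint by energy, and the vacated site identifies the
  particle that moved. The generator thus becomes a sum over particles, the form in which the
  rightmost particle can be singled out.\<close>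

lemma sum_rate:
  assumes "reachable x"
  shows "(\<Sum>y\<in>nbs x. rate p x y * g y) =
    p * (\<Sum>i\<in>right_sites x. g (move x i 1)) + (1 - p) * (\<Sum>i\<in>left_sites x. g (move x i (-1)))"
proof -
  have U: "nbs x = right_nbs x \<union> left_nbs x" by (auto simp: nbs_def right_nbs_def left_nbs_def)
  have "right_nbs x \<inter> left_nbs x = {}"
    using energy_right_jump[OF assms] energy_left_jump[OF assms]
    by (fastforce simp: right_nbs_def left_nbs_def)
  moreover have "finite (right_nbs x)" "finite (left_nbs x)"
    using card_right_sites[OF assms] by (simp_all add: right_nbs_eq left_nbs_eq)
  ultimately have "(\<Sum>y\<in>nbs x. rate p x y * g y) =
      (\<Sum>y\<in>right_nbs x. rate p x y * g y) + (\<Sum>y\<in>left_nbs x. rate p x y * g y)"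
    unfolding U by (intro sum.union_disjoint)
  also have "(\<Sum>y\<in>right_nbs x. rate p x y * g y) = p * (\<Sum>y\<in>right_nbs x. g y)"
    unfolding sum_distrib_left
    by (rule sum.cong) (use rate_right[OF assms] in \<open>auto simp: right_nbs_def\<close>)
  also have "(\<Sum>y\<in>left_nbs x. rate p x y * g y) = (1 - p) * (\<Sum>y\<in>left_nbs x. g y)"
    unfolding sum_distrib_left
    by (rule sum.cong) (use rate_left[OF assms] in \<open>auto simp: left_nbs_def\<close>)
  finally show ?thesis
    by (simp only: right_nbs_eq left_nbs_eq sum.reindex[OF inj_on_move_right]
        sum.reindex[OF inj_on_move_left] o_def)
qed

lemma qrate_eq: "qrate p x = p * card (right_sites x) + (1 - p) * card (left_sites x)"
  by (simp add: qrate_def right_sites_def left_sites_def)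

lemma sum_rate_eq_qrate: "reachable x \<Longrightarrow> (\<Sum>y\<in>nbs x. rate p x y) = qrate p x"
  using sum_rate[of x p "\<lambda>_. 1"] by (simp add: qrate_eq)

text \<open>With b left sites and b + 1 right sites the total rate is b + p, so exchanging p and 1 -
  p shifts it by the same amount in every state.\<close>

lemma qrate_swap: "reachable x \<Longrightarrow> qrate p x = qrate (1 - p) x + (2 * p - 1)"
  using card_right_sites(3) by (simp add: qrate_eq algebra_simps)

lemma qrate_nonneg: "0 \<le> p \<Longrightarrow> p \<le> 1 \<Longrightarrow> 0 \<le> qrate p x"
  by (simp add: qrate_eq)

text \<open>The particles of a reachable configuration, listed from right to left (from index 0).\<close>

definition listing :: "config \<Rightarrow> (nat \<Rightarrow> int) \<Rightarrow> bool" where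
  "listing x \<kappa> \<longleftrightarrow> (\<forall>m n. m < n \<longrightarrow> \<kappa> n < \<kappa> m) \<and> range \<kappa> = x \<and>
     (\<exists>N. (\<forall>n\<ge>N. \<kappa> n = - int n - 1) \<and> int (energy x) = (\<Sum>n<N. \<kappa> n + int n + 1))"

lemma listing_move:
  assumes "listing x \<kappa>" "reachable x" "i \<in> x" "i + d \<notin> x" "d = 1 \<or> d = - 1"
  shows "\<exists>\<kappa>'. listing (move x i d) \<kappa>'"
proof -
  from assms obtain k where k: "i = \<kappa> k" by (auto simp: listing_def)
  have dec: "\<kappa> n < \<kappa> m" if "m < n" for m n using assms that by (auto simp: listing_def)
  have ran: "range \<kappa> = x" using assms by (simp add: listing_def)
  obtain N where N: "\<And>n. n \<ge> N \<Longrightarrow> \<kappa> n = - int n - 1"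
    "int (energy x) = (\<Sum>n<N. \<kappa> n + int n + 1)" using assms by (auto simp: listing_def)
  define \<kappa>' where "\<kappa>' = \<kappa>(k := \<kappa> k + d)"
  \<comment> \<open>The moved particle may come from the undisplaced tail, so the cutoff must also
    exceed k.\<close>
  define N' where "N' = max N (Suc k)"
  \<comment> \<open>Positions are integers and the target is empty, so a unit step cannot change the
    order of the particles.\<close>
  have ne: "\<kappa> n \<noteq> \<kappa> k + d" for n using assms(4) ran k by (metis rangeI)
  have dec': "\<kappa>' n < \<kappa>' m" if "m < n" for m n
    using dec[OF that] ne[of m] ne[of n] assms(5) that by (auto simp: \<kappa>'_def)
  have inj: "\<kappa> n = \<kappa> k \<longleftrightarrow> n = k" for n
    using dec[of n k] dec[of k n] by (metis less_irrefl nat_neq_iff)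
  have ran': "range \<kappa>' = move x i d"
    unfolding ran[symmetric] k \<kappa>'_def by (auto simp: inj image_iff)
  have "(\<Sum>n<N. \<kappa> n + int n + 1) = (\<Sum>n<N'. \<kappa> n + int n + 1)"
    by (rule sum.mono_neutral_left) (auto simp: N'_def N)
  moreover have "(\<Sum>n<N'. \<kappa>' n + int n + 1) = (\<Sum>n<N'. \<kappa> n + int n + 1 + (if n = k then d else 0))"
    by (rule sum.cong) (auto simp: \<kappa>'_def)
  moreover have "\<dots> = (\<Sum>n<N'. \<kappa> n + int n + 1) + d"
    unfolding sum.distrib by (simp add: N'_def)
  ultimately have "int (energy (move x i d)) = (\<Sum>n<N'. \<kappa>' n + int n + 1)"
    using energy_move[OF reachable_finite_defects[OF assms(2)] assms(3,4)] N(2) by simp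
  moreover have "\<kappa>' n = - int n - 1" if "n \<ge> N'" for n using that N by (auto simp: N'_def \<kappa>'_def)
  ultimately show ?thesis unfolding listing_def using dec' ran' by blast
qed

lemma ex_listing: "reachable x \<Longrightarrow> \<exists>\<kappa>. listing x \<kappa>"
proof (induction rule: reachable.induct)
  case reachable_O
  have "range (\<lambda>n. - int n - 1) = O_conf"
    unfolding O_conf_def by (auto simp: image_iff) presburger
  then have "listing O_conf (\<lambda>n. - int n - 1)"
    unfolding listing_def by (auto intro!: exI[of _ 0])
  then show ?case by blast
next
  case (reachable_right x y)
  then show ?case using listing_move[where d = 1] by (auto simp: right_jump_def)
next
  case (reachable_left x y)
  then show ?case using listing_move[where d = "-1"] by (auto simp: left_jump_def)
qed

text \<open>Exactly the \<open>n\<close> earlier entries of the listing lie to the right of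
  \<open>\<kappa> n\<close>. The index shift arises because listings start at 0 while
  \<open>kth_pos\<close> counts from 1.\<close>

lemma kth_pos_listing:
  assumes "listing x \<kappa>" "k \<ge> 1"
  shows "kth_pos x k = \<kappa> (k - 1)"
proof -
  have dec: "\<kappa> n < \<kappa> m \<longleftrightarrow> m < n" for m n
    using assms by (metis less_asym listing_def nat_neq_iff)
  have ran: "range \<kappa> = x" using assms by (simp add: listing_def)
  have inj: "inj \<kappa>" using dec by (metis injI less_irrefl nat_neq_iff)
  have "{j \<in> x. j > \<kappa> n} = \<kappa> ` {..<n}" for n unfolding ran[symmetric] by (auto simp: dec)
  then have crd: "card {j \<in> x. j > \<kappa> n} = n" for n
    using inj by (simp add: card_image inj_on_subset)
  show ?thesis unfolding kth_pos_def
  proof (rule the_equality)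
    show "\<kappa> (k - 1) \<in> x \<and> card {j \<in> x. j > \<kappa> (k - 1)} = k - 1" using crd ran by blast
  next
    fix i assume *: "i \<in> x \<and> card {j \<in> x. j > i} = k - 1"
    then obtain n where "i = \<kappa> n" using ran by auto
    then show "i = \<kappa> (k - 1)" using crd[of n] * by simp
  qed
qed

lemma Dist_eq_energy:
  assumes "reachable x"
  shows "Dist x = int (energy x)"
proof -
  obtain \<kappa> where \<kappa>: "listing x \<kappa>" using ex_listing[OF assms] by blast
  then obtain N where N: "\<And>n. n \<ge> N \<Longrightarrow> \<kappa> n = - int n - 1"
    "int (energy x) = (\<Sum>n<N. \<kappa> n + int n + 1)" by (auto simp: listing_def)
  have "Dist x = (\<Sum>k\<in>Suc ` {..<N}. kth_pos x k + int k)"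
    unfolding Dist_def
  proof (rule sum.mono_neutral_left)
    show "{k. 1 \<le> k \<and> kth_pos x k \<noteq> - int k} \<subseteq> Suc ` {..<N}"
    proof
      fix k assume *: "k \<in> {k. 1 \<le> k \<and> kth_pos x k \<noteq> - int k}"
      then have "\<kappa> (k - 1) \<noteq> - int (k - 1) - 1" using kth_pos_listing[OF \<kappa>, of k] by auto
      then have "k - 1 < N" using N(1) by (meson not_le)
      then show "k \<in> Suc ` {..<N}" using * by (auto intro!: image_eqI[of _ _ "k - 1"])
    qed
  qed auto
  also have "\<dots> = (\<Sum>n<N. \<kappa> n + int n + 1)"
    by (simp add: sum.reindex kth_pos_listing[OF \<kappa>] algebra_simps)
  finally show ?thesis using N by simp
qed

lemma Mpos_unique: "m \<in> x \<Longrightarrow> (\<And>j. j \<in> x \<Longrightarrow> j \<le> m) \<Longrightarrow> Mpos x = m"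
  unfolding Mpos_def by (rule Greatest_equality)

text \<open>The lower bound holds since a strictly decreasing listing has
  \<open>\<kappa> n + int n \<le> \<kappa> 0\<close>, with left side -1 far out. For the upper
  bound, a rightmost particle at a nonnegative site is itself a defect; this gives the comparison of
  M with D in the theorem.\<close>

lemma Mpos_reachable:
  assumes "reachable x"
  shows "Mpos x \<in> x" "j \<in> x \<Longrightarrow> j \<le> Mpos x" "Mpos x \<ge> - 1" "Mpos x \<le> int (energy x)"
proof -
  obtain \<kappa> where \<kappa>: "listing x \<kappa>" using ex_listing[OF assms] by blast
  have dec: "\<kappa> n \<le> \<kappa> m" if "m \<le> n" for m n
    using \<kappa> that unfolding listing_def by (metis le_less)
  have ran: "range \<kappa> = x" using \<kappa> by (simp add: listing_def)
  obtain N where N: "\<And>n. n \<ge> N \<Longrightarrow> \<kappa> n = - int n - 1" using \<kappa> by (auto simp: listing_def)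
  have M: "Mpos x = \<kappa> 0" by (rule Mpos_unique) (use ran dec in auto)
  show "Mpos x \<in> x" using ran M by auto
  show "j \<in> x \<Longrightarrow> j \<le> Mpos x" using ran M dec by auto
  have "\<kappa> n + int n \<le> \<kappa> 0" for n
  proof (induction n)
    case (Suc n)
    have "\<kappa> (Suc n) < \<kappa> n" using \<kappa> unfolding listing_def by blast
    then show ?case using Suc by simp
  qed simp
  from this[of N] show "Mpos x \<ge> - 1" using N[of N] M by simp
  show "Mpos x \<le> int (energy x)"
  proof (cases "Mpos x \<ge> 0")
    case True
    then have "Mpos x \<in> defects x" using \<open>Mpos x \<in> x\<close> by (auto simp: defects_def)
    then show ?thesis using defects_subset_energy[OF reachable_finite_defects[OF assms]] by auto
  qed auto
qed

lemma Mpos_O: "Mpos O_conf = - 1"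
  by (rule Mpos_unique) (auto simp: O_conf_def)

section \<open>Generating function of the energy\<close>

lemma inj_defects: "inj defects"
proof (rule injI)
  fix x y assume "defects x = defects y"
  then have "(i \<in> x) = (i \<in> y)" for i by (auto simp: defects_def set_eq_iff)
  then show "x = y" by auto
qed

text \<open>A configuration is determined by its defect set. Summing over all subsets of a window
  instead gives a product of factors 1 + r^|i|, hence an exponential of two geometric series. The
  bound is uniform in \<open>A\<close>.\<close>

lemma sum_pow_energy_le:
  fixes r :: real
  assumes "0 < r" "r < 1" "finite A" "\<And>x. x \<in> A \<Longrightarrow> reachable x"
  shows "(\<Sum>x\<in>A. r ^ energy x) \<le> exp (2 / (1 - r))"
proof -
  define N where "N = Max (insert 0 (energy ` A))"
  have N: "energy x \<le> N" if "x \<in> A" for x using that assms(3) by (auto simp: N_def)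
  define I where "I = {- int N..int N}"
  have sub: "defects x \<subseteq> I" if "x \<in> A" for x
    using defects_subset_energy[OF reachable_finite_defects[OF assms(4)[OF that]]] N[OF that]
    unfolding I_def by fastforce
  have inj: "inj_on defects A" using inj_defects by (rule inj_on_subset) simp
  have "(\<Sum>x\<in>A. r ^ energy x) = (\<Sum>x\<in>A. \<Prod>i\<in>defects x. r ^ nat \<bar>i\<bar>)"
    by (simp add: energy_def power_sum)
  also have "\<dots> = (\<Sum>S\<in>defects ` A. \<Prod>i\<in>S. r ^ nat \<bar>i\<bar>)"
    by (simp add: sum.reindex[OF inj])
  also have "\<dots> \<le> (\<Sum>S\<in>Pow I. \<Prod>i\<in>S. r ^ nat \<bar>i\<bar>)"
    by (rule sum_mono2) (use sub assms in \<open>auto simp: I_def intro!: prod_nonneg\<close>)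
  also have "\<dots> = (\<Prod>i\<in>I. r ^ nat \<bar>i\<bar> + 1)"
    by (subst prod_add) (auto simp: I_def)
  also have "\<dots> \<le> (\<Prod>i\<in>I. exp (r ^ nat \<bar>i\<bar>))"
    by (rule prod_mono) (use assms in \<open>auto simp: add.commute exp_ge_add_one_self\<close>)
  also have "\<dots> = exp (\<Sum>i\<in>I. r ^ nat \<bar>i\<bar>)" by (simp add: exp_sum I_def)
  also have "(\<Sum>i\<in>I. r ^ nat \<bar>i\<bar>) \<le> 2 / (1 - r)"
  proof -
    have geo: "(\<Sum>n\<le>N. r ^ n) \<le> 1 / (1 - r)"
      using assms by (simp add: sum_gp0 divide_right_mono)
    have "I \<subseteq> int ` {..N} \<union> (\<lambda>n. - int n) ` {..N}"
    proof
      fix i assume "i \<in> I"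
      then have "nat \<bar>i\<bar> \<in> {..N}" "i = int (nat \<bar>i\<bar>) \<or> i = - int (nat \<bar>i\<bar>)" by (auto simp: I_def)
      then show "i \<in> int ` {..N} \<union> (\<lambda>n. - int n) ` {..N}" by blast
    qed
    then have "(\<Sum>i\<in>I. r ^ nat \<bar>i\<bar>) \<le> (\<Sum>i\<in>int ` {..N} \<union> (\<lambda>n. - int n) ` {..N}. r ^ nat \<bar>i\<bar>)"
      by (rule sum_mono2[rotated]) (use assms in auto)
    also have "\<dots> \<le> (\<Sum>i\<in>int ` {..N}. r ^ nat \<bar>i\<bar>) + (\<Sum>i\<in>(\<lambda>n. - int n) ` {..N}. r ^ nat \<bar>i\<bar>)"
      using sum.union_inter[of "int ` {..N}" "(\<lambda>n. - int n) ` {..N}" "\<lambda>i. r ^ nat \<bar>i\<bar>"]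
        sum_nonneg[of "int ` {..N} \<inter> (\<lambda>n. - int n) ` {..N}" "\<lambda>i. r ^ nat \<bar>i\<bar>"] assms by simp
    also have "\<dots> = (\<Sum>n\<le>N. r ^ n) + (\<Sum>n\<le>N. r ^ n)"
      by (simp add: sum.reindex inj_on_def)
    also have "\<dots> \<le> 2 / (1 - r)" using geo by simp
    finally show ?thesis .
  qed
  finally show ?thesis by simp
qed

lemma finite_energy_le: "finite {x. reachable x \<and> energy x \<le> N}"
proof (rule finite_imageD)
  have "defects ` {x. reachable x \<and> energy x \<le> N} \<subseteq> Pow {- int N..int N}"
    using defects_subset_energy[OF reachable_finite_defects] by fastforce
  then show "finite (defects ` {x. reachable x \<and> energy x \<le> N})"
    by (rule finite_subset) simp
  show "inj_on defects {x. reachable x \<and> energy x \<le> N}"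
    using inj_defects by (rule inj_on_subset) simp
qed

section \<open>Path probabilities\<close>

lemma continuous_on_atLeast_if_Icc:
  fixes f :: "real \<Rightarrow> real"
  assumes "\<And>b. continuous_on {a..b} f"
  shows "continuous_on {a..} f"
  unfolding continuous_on_eq_continuous_within
proof
  fix x assume "x \<in> {a..}"
  then have "continuous (at x within {a..x + 1}) f"
    using assms[of "x + 1"] by (auto simp: continuous_on_eq_continuous_within)
  moreover have "at x within {a..} = at x within {a..x + 1}"
    by (rule at_within_nhd[where S = "{..<x + 1}"]) auto
  ultimately show "continuous (at x within {a..}) f" by simp
qed

text \<open>Reflecting the integration variable moves t out of the integrand, leaving an exponential
  times an indefinite integral, ready for differentiation. The two claims are proved together: the
  formula for a path uses continuity for its tail, and continuity for the path follows from the
  formula.\<close>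

lemma path_prob_continuous_on: "continuous_on {0..} (path_prob p xs)"
  and path_prob_Cons_Cons:
    "0 \<le> t \<Longrightarrow> path_prob p (x # y # r) t = exp (- qrate p x * t) * (rate p x y *
       integral {0..t} (\<lambda>s. exp (qrate p x * s) * path_prob p (y # r) s))"
proof -
  have step: "path_prob p (x # y # r) t = exp (- qrate p x * t) * (rate p x y *
       integral {0..t} (\<lambda>s. exp (qrate p x * s) * path_prob p (y # r) s))"
    if cont: "continuous_on {0..} (path_prob p (y # r))" and "0 \<le> t" for x y r t
  proof -
    let ?f = "\<lambda>s. exp (- qrate p x * s) * rate p x y * path_prob p (y # r) (t - s)"
    have "continuous_on {0..t} (path_prob p (y # r) \<circ> (\<lambda>s. t - s))"
      by (rule continuous_on_compose)
        (auto intro!: continuous_intros continuous_on_subset[OF cont])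
    then have "continuous_on {0..t} ?f"
      by (intro continuous_intros) (auto simp: o_def)
    then have "set_integrable lborel {0..t} ?f" by (rule borel_integrable_atLeastAtMost')
    then have "path_prob p (x # y # r) t = integral {0..t} ?f"
      by (simp add: set_borel_integral_eq_integral)
    also have "\<dots> = integral {0..t} (\<lambda>s. ?f (t - s))"
    proof -
      have "(?f has_integral integral {0..t} ?f) (cbox 0 t)"
        using \<open>continuous_on {0..t} ?f\<close> by (simp add: integrable_continuous_interval integrable_integral)
      from has_integral_affinity[OF this, of "-1" t]
      have "((\<lambda>s. ?f (t - s)) has_integral integral {0..t} ?f) ((\<lambda>s. t - s) ` {0..t})"
        by (simp add: algebra_simps)
      moreover have "(\<lambda>s. t - s) ` {0..t} = {0..t}"
        by (auto simp: image_iff intro: bexI[of _ "t - _"])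
      ultimately show ?thesis by (simp add: integral_unique)
    qed
    also have "\<dots> = integral {0..t} (\<lambda>s. exp (- qrate p x * t) * rate p x y * (exp (qrate p x * s) * path_prob p (y # r) s))"
      by (rule integral_cong) (simp add: algebra_simps exp_diff exp_minus exp_add[symmetric] divide_simps)
    finally show ?thesis by simp
  qed
  show cont: "continuous_on {0..} (path_prob p xs)" for xs
  proof (induction xs rule: induct_list012)
    case (3 x y r)
    have "continuous_on {0..b} (path_prob p (x # y # r))" for b
    proof -
      have "continuous_on {0..b} (\<lambda>t. exp (- qrate p x * t) * (rate p x y *
         integral {0..t} (\<lambda>s. exp (qrate p x * s) * path_prob p (y # r) s)))"
        by (intro continuous_intros indefinite_integral_continuous_1 integrable_continuous_interval
            continuous_on_subset[OF 3(2)]) auto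
      then show ?thesis
        by (rule continuous_on_eq) (simp add: step[OF 3(2)] del: path_prob.simps)
    qed
    then show ?case by (rule continuous_on_atLeast_if_Icc)
  qed (auto intro!: continuous_intros)
  show "0 \<le> t \<Longrightarrow> path_prob p (x # y # r) t = exp (- qrate p x * t) * (rate p x y *
       integral {0..t} (\<lambda>s. exp (qrate p x * s) * path_prob p (y # r) s))"
    using step[OF cont] .
qed


text \<open>The backward equation along a single path; from here on, first-jump integrals are
  replaced by derivatives. Time 0 is excluded because the formula for \<open>path_prob\<close> is
  available only on one side of it.\<close>

lemma path_prob_has_derivative:
  assumes "0 < t"
  shows "(path_prob p (x # y # r) has_real_derivative
    - qrate p x * path_prob p (x # y # r) t + rate p x y * path_prob p (y # r) t) (at t)"
proof -
  define g where "g = (\<lambda>s. exp (qrate p x * s) * path_prob p (y # r) s)"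
  define G where "G = (\<lambda>t. exp (- qrate p x * t) * (rate p x y * integral {0..t} g))"
  have "continuous_on {0..t+1} g" unfolding g_def
    by (intro continuous_intros continuous_on_subset[OF path_prob_continuous_on]) auto
  then have "((\<lambda>t. integral {0..t} g) has_real_derivative g t) (at t within {0..t+1})"
    using assms by (intro integral_has_real_derivative) auto
  then have I: "((\<lambda>t. integral {0..t} g) has_real_derivative g t) (at t)"
    using assms by (simp add: at_within_Icc_at)
  have "(G has_real_derivative - qrate p x * G t + rate p x y * path_prob p (y # r) t) (at t)"
    unfolding G_def
    by (rule derivative_eq_intros I refl | simp add: g_def exp_minus field_simps)+
  moreover have "\<forall>\<^sub>F s in nhds t. path_prob p (x # y # r) s = G s"
  proof -
    have "\<forall>\<^sub>F s in nhds t. s \<in> {0<..}" using assms by (intro eventually_nhds_in_open) auto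
    then show ?thesis
      by eventually_elim (simp add: path_prob_Cons_Cons G_def g_def del: path_prob.simps)
  qed
  moreover have "path_prob p (x # y # r) t = G t"
    using assms by (simp add: path_prob_Cons_Cons G_def g_def del: path_prob.simps)
  ultimately show ?thesis by (simp only: DERIV_cong_ev[OF refl _ refl])
qed

lemma path_prob_Cons_Cons_0: "path_prob p (x # y # r) 0 = 0"
  by (simp add: path_prob_Cons_Cons del: path_prob.simps)

lemma path_prob_nonneg:
  assumes "0 \<le> p" "p \<le> 1" "0 \<le> t"
  shows "0 \<le> path_prob p xs t"
  using assms(3)
proof (induction xs arbitrary: t rule: induct_list012)
  case (3 x y r)
  have "0 \<le> integral {0..t} (\<lambda>s. exp (qrate p x * s) * path_prob p (y # r) s)"
    by (rule integral_nonneg) (auto intro!: integrable_continuous_interval continuous_intros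
        continuous_on_subset[OF path_prob_continuous_on] simp: 3 simp del: path_prob.simps)
  then show ?case
    using 3 rate_nonneg[OF assms(1,2)] by (simp add: path_prob_Cons_Cons del: path_prob.simps)
qed auto

text \<open>The common shift of all total rates yields the exponential. Each left jump contributes a
  factor (1-p)/p and each right jump its inverse; on a path ending at \<open>O_conf\<close> the
  surplus of left jumps is the initial energy. A general starting point is taken for the sake of the
  induction.\<close>

lemma path_prob_swap:
  assumes p: "0 < p" "p < 1"
    and "xs \<noteq> []" "reachable (hd xs)" "last xs = O_conf"
    and "\<And>i. Suc i < length xs \<Longrightarrow> right_jump (xs ! i) (xs ! Suc i) \<or> left_jump (xs ! i) (xs ! Suc i)"
    and "0 \<le> t"
  shows "path_prob p xs t =
    ((1 - p) / p) ^ energy (hd xs) * exp (- (2 * p - 1) * t) * path_prob (1 - p) xs t"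
  using assms(3-)
proof (induction xs arbitrary: t rule: induct_list012)
  case (2 x)
  then have "x = O_conf" by simp
  then show ?case
    by (simp add: qrate_swap[OF reachable_O, of p] exp_add[symmetric] algebra_simps)
next
  case (3 x y r)
  let ?R = "(1 - p) / p"
  have jump: "right_jump x y \<or> left_jump x y" using 3(6)[of 0] by simp
  then have y: "reachable y" using 3(4) by (auto intro: reachable_right reachable_left)
  have IH: "path_prob p (y # r) s =
      ?R ^ energy y * exp (- (2 * p - 1) * s) * path_prob (1 - p) (y # r) s" if "0 \<le> s" for s
    using 3(2)[of s] 3(5) 3(6)[of "Suc _"] y that by (simp del: path_prob.simps)
  have qx: "qrate p x = qrate (1 - p) x + (2 * p - 1)" by (rule qrate_swap) (use 3(4) in simp)
  have rate: "rate p x y * ?R ^ energy y = ?R ^ energy x * rate (1 - p) x y"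
    using jump
  proof
    assume "right_jump x y"
    then show ?thesis
      using p energy_right_jump[of x y] rate_right[of x y] 3(4) by simp
  next
    assume "left_jump x y"
    then show ?thesis
      using p energy_left_jump[of x y] rate_left[of x y] 3(4) by simp
  qed
  have "integral {0..t} (\<lambda>s. exp (qrate p x * s) * path_prob p (y # r) s) =
      integral {0..t} (\<lambda>s. ?R ^ energy y * (exp (qrate (1 - p) x * s) * path_prob (1 - p) (y # r) s))"
    by (rule integral_cong)
      (use IH in \<open>simp add: qx exp_add[symmetric] algebra_simps del: path_prob.simps\<close>)
  then have "path_prob p (x # y # r) t = exp (- qrate p x * t) * (rate p x y * ?R ^ energy y) *
      integral {0..t} (\<lambda>s. exp (qrate (1 - p) x * s) * path_prob (1 - p) (y # r) s)"
    using 3(7) by (simp add: path_prob_Cons_Cons del: path_prob.simps)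
  also have "exp (- qrate p x * t) = exp (- (2 * p - 1) * t) * exp (- qrate (1 - p) x * t)"
    by (simp add: qx exp_add[symmetric] algebra_simps)
  finally show ?case using 3(7)
    by (simp add: path_prob_Cons_Cons rate del: path_prob.simps)
qed auto

text \<open>Sorting by the number of jumps makes each family finite, so that sums over paths can be
  differentiated termwise. Confinement to \<open>A\<close> models a chain killed on leaving
  \<open>A\<close>.\<close>

primrec paths_in :: "config set \<Rightarrow> nat \<Rightarrow> config \<Rightarrow> config list set" where
  "paths_in A 0 x = (if x \<in> A \<and> x = O_conf then {[x]} else {})"
| "paths_in A (Suc n) x = (if x \<in> A then \<Union>y\<in>nbs x. (#) x ` paths_in A n y else {})"

lemma paths_in_iff:
  "xs \<in> paths_in A n x \<longleftrightarrow> length xs = Suc n \<and> hd xs = x \<and> last xs = O_conf \<and> set xs \<subseteq> A \<and>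
    (\<forall>i. Suc i < length xs \<longrightarrow> right_jump (xs ! i) (xs ! Suc i) \<or> left_jump (xs ! i) (xs ! Suc i))"
proof (induction n arbitrary: x xs)
  case 0
  show ?case by (cases xs) auto
next
  case (Suc n)
  show ?case
  proof (cases xs)
    case (Cons z zs)
    show ?thesis
    proof (cases zs)
      case (Cons w ws)
      have "(\<forall>i. Suc i < length (z # w # ws) \<longrightarrow> right_jump ((z # w # ws) ! i) ((z # w # ws) ! Suc i)
            \<or> left_jump ((z # w # ws) ! i) ((z # w # ws) ! Suc i)) \<longleftrightarrow>
          w \<in> nbs z \<and> (\<forall>i. Suc i < length (w # ws) \<longrightarrow> right_jump ((w # ws) ! i) ((w # ws) ! Suc i)
            \<or> left_jump ((w # ws) ! i) ((w # ws) ! Suc i))"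
        (is "?P \<longleftrightarrow> ?Q")
      proof
        assume ?P then show ?Q unfolding nbs_def by (auto dest: spec[of _ "Suc _"] spec[of _ 0])
      next
        assume ?Q then show ?P unfolding nbs_def by (auto simp: nth_Cons split: nat.split)
      qed
      then show ?thesis unfolding \<open>xs = z # zs\<close> Cons paths_in.simps
        by (auto simp: Suc.IH image_iff)
    qed (use \<open>xs = z # zs\<close> in \<open>auto simp: Suc.IH\<close>)
  qed auto
qed

lemma finite_paths_in: "reachable x \<Longrightarrow> finite (paths_in A n x)"
  by (induction n arbitrary: x) (auto simp: finite_nbs reachable_nbs)

lemma paths_in_mono: "A \<subseteq> B \<Longrightarrow> paths_in A n x \<subseteq> paths_in B n x"
  unfolding paths_in_iff subset_iff by blast

lemma reachable_on_paths:
  assumes "xs \<in> paths_in A n x" "reachable x"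
  shows "set xs \<subseteq> {x. reachable x}"
  using assms
proof (induction n arbitrary: x xs)
  case (Suc n)
  then obtain y ys where "y \<in> nbs x" "ys \<in> paths_in A n y" "xs = x # ys"
    by (auto split: if_splits)
  then show ?case using Suc.IH[of ys y] Suc.prems reachable_nbs by auto
qed (auto split: if_splits)

lemma paths_O_O_eq: "paths_O_O = (\<Union>n. paths_in {x. reachable x} n O_conf)"
proof -
  have "paths_O_O = (\<Union>n. paths_in UNIV n O_conf)"
  proof (intro set_eqI iffI)
    fix xs assume "xs \<in> paths_O_O"
    then have "xs \<in> paths_in UNIV (length xs - 1) O_conf"
      by (simp add: paths_in_iff paths_O_O_def)
    then show "xs \<in> (\<Union>n. paths_in UNIV n O_conf)" by blast
  next
    fix xs assume "xs \<in> (\<Union>n. paths_in UNIV n O_conf)"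
    then obtain n where "xs \<in> paths_in UNIV n O_conf" by blast
    then show "xs \<in> paths_O_O" unfolding paths_in_iff paths_O_O_def by auto
  qed
  moreover have "paths_in UNIV n O_conf = paths_in {x. reachable x} n O_conf" for n
    using reachable_on_paths[OF _ reachable_O, of _ UNIV n]
    unfolding set_eq_iff paths_in_iff by blast
  ultimately show ?thesis by simp
qed

section \<open>The backward equation\<close>

text \<open>Comparison arguments for the backward equation end here: the derivative is known only at
  positive times, and continuity covers time 0.\<close>

lemma increasing_from_0:
  fixes g :: "real \<Rightarrow> real"
  assumes "continuous_on {0..} g" "0 \<le> t"
    and "\<And>s. 0 < s \<Longrightarrow> (g has_real_derivative g' s) (at s)" "\<And>s. 0 < s \<Longrightarrow> 0 \<le> g' s"
  shows "g 0 \<le> g t"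
  by (rule DERIV_nonneg_imp_increasing_open[OF assms(2)])
    (use assms(3,4) in \<open>auto intro: continuous_on_subset[OF assms(1)]\<close>)

section \<open>Truncated return probabilities\<close>

locale exclusion =
  fixes p :: real
  assumes p_pos: "0 < p" and p_less_1: "p < 1"
begin

text \<open>\<open>return_n A n x t\<close> is the probability to be at \<open>O_conf\<close> at time \<open>t\<close> after exactly \<open>n\<close>
  jumps inside \<open>A\<close>, and \<open>return_lt A n x t\<close> the one for fewer than \<open>n\<close> jumps.\<close>

definition return_n :: "config set \<Rightarrow> nat \<Rightarrow> config \<Rightarrow> real \<Rightarrow> real" where
  "return_n A n x t = (\<Sum>xs\<in>paths_in A n x. path_prob p xs t)"

definition return_lt :: "config set \<Rightarrow> nat \<Rightarrow> config \<Rightarrow> real \<Rightarrow> real" where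
  "return_lt A n x t = (\<Sum>k<n. return_n A k x t)"

lemma return_n_outside: "x \<notin> A \<Longrightarrow> return_n A n x t = 0"
  by (cases n) (auto simp: return_n_def)

lemma return_lt_outside: "x \<notin> A \<Longrightarrow> return_lt A n x t = 0"
  by (simp add: return_lt_def return_n_outside)

lemma return_n_nonneg: "0 \<le> t \<Longrightarrow> 0 \<le> return_n A n x t"
  unfolding return_n_def by (intro sum_nonneg path_prob_nonneg) (use p_pos p_less_1 in auto)

lemma return_lt_nonneg: "0 \<le> t \<Longrightarrow> 0 \<le> return_lt A n x t"
  unfolding return_lt_def by (intro sum_nonneg return_n_nonneg)

lemma return_n_mono:
  assumes "A \<subseteq> B" "reachable x" "0 \<le> t" shows "return_n A n x t \<le> return_n B n x t"
  unfolding return_n_def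
  by (intro sum_mono2 paths_in_mono path_prob_nonneg finite_paths_in)
    (use assms p_pos p_less_1 in auto)

lemma return_n_Suc:
  assumes "reachable x" "x \<in> A"
  shows "return_n A (Suc n) x t = (\<Sum>y\<in>nbs x. \<Sum>ys\<in>paths_in A n y. path_prob p (x # ys) t)"
proof -
  have "return_n A (Suc n) x t = (\<Sum>y\<in>nbs x. \<Sum>xs\<in>(#) x ` paths_in A n y. path_prob p xs t)"
    unfolding return_n_def paths_in.simps if_P[OF assms(2)]
  proof (rule sum.UNION_disjoint)
    show "finite (nbs x)" using assms finite_nbs by blast
    show "\<forall>y\<in>nbs x. finite ((#) x ` paths_in A n y)"
      using assms finite_paths_in reachable_nbs by blast
    show "\<forall>y\<in>nbs x. \<forall>z\<in>nbs x. y \<noteq> z \<longrightarrow> (#) x ` paths_in A n y \<inter> (#) x ` paths_in A n z = {}"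
      by (auto simp: paths_in_iff)
  qed
  then show ?thesis by (simp add: sum.reindex)
qed

lemma return_n_continuous_on [continuous_intros]: "continuous_on {0..} (return_n A n x)"
  unfolding return_n_def[abs_def] by (intro continuous_intros path_prob_continuous_on)

lemma return_lt_continuous_on [continuous_intros]: "continuous_on {0..} (return_lt A n x)"
  unfolding return_lt_def[abs_def] by (intro continuous_intros)

lemma return_n_at_0: "return_n A n x 0 = of_bool (n = 0 \<and> x = O_conf \<and> x \<in> A)"
proof (cases n)
  case (Suc m)
  have "path_prob p xs 0 = 0" if "xs \<in> paths_in A n x" for xs
  proof -
    have "length xs = Suc (Suc m)" using that Suc unfolding paths_in_iff by blast
    then obtain y z r where "xs = y # z # r" by (auto simp: length_Suc_conv)
    then show ?thesis by (simp only: path_prob_Cons_Cons_0)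
  qed
  then show ?thesis using Suc by (simp add: return_n_def)
qed (auto simp: return_n_def)

lemma return_lt_at_0: "return_lt A (Suc n) x 0 = of_bool (x = O_conf \<and> x \<in> A)"
  unfolding return_lt_def return_n_at_0 by (induction n) auto

lemma return_n_0_has_derivative:
  "(return_n A 0 x has_real_derivative - qrate p x * return_n A 0 x t) (at t)"
proof (cases "x = O_conf \<and> x \<in> A")
  case True
  then have "return_n A 0 x = (\<lambda>t. exp (- qrate p x * t))" by (auto simp: return_n_def)
  then show ?thesis by (auto intro!: derivative_eq_intros)
next
  case False
  then have "return_n A 0 x = (\<lambda>t. 0)" by (auto simp: return_n_def)
  then show ?thesis by simp
qed

lemma return_n_Suc_has_derivative:
  assumes "reachable x" "x \<in> A" "0 < t"
  shows "(return_n A (Suc n) x has_real_derivative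
    - qrate p x * return_n A (Suc n) x t + (\<Sum>y\<in>nbs x. rate p x y * return_n A n y t)) (at t)"
proof -
  have D: "((\<lambda>t. path_prob p (x # ys) t) has_real_derivative
      - qrate p x * path_prob p (x # ys) t + rate p x y * path_prob p ys t) (at t)"
    if "ys \<in> paths_in A n y" for y ys
  proof -
    from that obtain r where "ys = y # r" by (cases ys) (auto simp: paths_in_iff)
    then show ?thesis using path_prob_has_derivative[OF assms(3)] by (simp del: path_prob.simps)
  qed
  have "((\<lambda>t. \<Sum>y\<in>nbs x. \<Sum>ys\<in>paths_in A n y. path_prob p (x # ys) t) has_real_derivative
      (\<Sum>y\<in>nbs x. \<Sum>ys\<in>paths_in A n y.
        - qrate p x * path_prob p (x # ys) t + rate p x y * path_prob p ys t)) (at t)"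
    by (intro DERIV_sum D)
  moreover have "(\<Sum>y\<in>nbs x. \<Sum>ys\<in>paths_in A n y.
        - qrate p x * path_prob p (x # ys) t + rate p x y * path_prob p ys t) =
      - qrate p x * return_n A (Suc n) x t + (\<Sum>y\<in>nbs x. rate p x y * return_n A n y t)"
    by (simp only: return_n_Suc[OF assms(1,2)] return_n_def[of A n] sum.distrib sum_distrib_left)
  moreover have "(\<lambda>t. \<Sum>y\<in>nbs x. \<Sum>ys\<in>paths_in A n y. path_prob p (x # ys) t) = return_n A (Suc n) x"
    using return_n_Suc[OF assms(1,2)] by (simp only: fun_eq_iff) blast
  ultimately show ?thesis by (simp only:)
qed

text \<open>The first jump uses up one unit of the jump budget, whence the cap \<open>n\<close> in
  the gain term against \<open>Suc n\<close> in the loss term. This mismatch is the price for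
  working with finite sums only.\<close>

lemma return_lt_Suc_has_derivative:
  assumes "reachable x" "x \<in> A" "0 < t"
  shows "(return_lt A (Suc n) x has_real_derivative
    - qrate p x * return_lt A (Suc n) x t + (\<Sum>y\<in>nbs x. rate p x y * return_lt A n y t)) (at t)"
proof (induction n)
  case 0
  show ?case using return_n_0_has_derivative[of A x t] by (simp add: return_lt_def[abs_def])
next
  case (Suc n)
  have split: "return_lt A (Suc k) z s = return_lt A k z s + return_n A k z s" for k z s
    by (simp add: return_lt_def)
  have "return_lt A (Suc (Suc n)) x = (\<lambda>t. return_lt A (Suc n) x t + return_n A (Suc n) x t)"
    using split by blast
  moreover have "(\<dots> has_real_derivative
      (- qrate p x * return_lt A (Suc n) x t + (\<Sum>y\<in>nbs x. rate p x y * return_lt A n y t)) +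
      (- qrate p x * return_n A (Suc n) x t + (\<Sum>y\<in>nbs x. rate p x y * return_n A n y t))) (at t)"
    by (intro DERIV_add Suc return_n_Suc_has_derivative assms)
  ultimately show ?case
    by (simp add: split[of "Suc n"] split[of n _ t] distrib_left sum.distrib algebra_simps)
qed

text \<open>Comparison principle for the chain killed outside \<open>A\<close>, by induction on the
  jump cap: if \<open>h\<close> decays at rate \<mu> under the generator, so does the return
  probability. It serves with \<open>h\<close> constant and with \<open>h\<close> a normalised
  hitting time.\<close>

lemma return_lt_le_supersolution:
  assumes A: "\<And>x. x \<in> A \<Longrightarrow> reachable x"
    and h: "\<And>x. 0 \<le> h x" "1 \<le> h O_conf"
    and super: "\<And>x. x \<in> A \<Longrightarrow> (\<Sum>y\<in>nbs x. rate p x y * h y) \<le> (qrate p x - \<mu>) * h x"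
    and "0 \<le> t"
  shows "return_lt A n x t \<le> exp (- \<mu> * t) * h x"
  using \<open>0 \<le> t\<close>
proof (induction n arbitrary: x t)
  case 0
  then show ?case using h by (simp add: return_lt_def)
next
  case (Suc n)
  show ?case
  proof (cases "x \<in> A")
    case False
    then show ?thesis using h by (simp add: return_lt_outside)
  next
    case True
    define q where "q = qrate p x"
    \<comment> \<open>The gap between the two sides times the integrating factor
      \<open>exp (q * s)\<close>, which removes the diagonal term of the equation.\<close>
    define g where "g = (\<lambda>s. exp ((q - \<mu>) * s) * h x - exp (q * s) * return_lt A (Suc n) x s)"
    define g' where "g' = (\<lambda>s. (q - \<mu>) * exp ((q - \<mu>) * s) * h x
      - exp (q * s) * (\<Sum>y\<in>nbs x. rate p x y * return_lt A n y s))"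
    have "g 0 \<le> g t"
    proof (rule increasing_from_0[where g' = g'])
      show "continuous_on {0..} g" unfolding g_def by (intro continuous_intros)
      fix s :: real assume s: "0 < s"
      show "(g has_real_derivative g' s) (at s)"
        unfolding g_def g'_def
        by (rule derivative_eq_intros return_lt_Suc_has_derivative A True s refl)+
          (simp add: q_def algebra_simps)
      have "(\<Sum>y\<in>nbs x. rate p x y * return_lt A n y s) \<le> (\<Sum>y\<in>nbs x. rate p x y * (exp (- \<mu> * s) * h y))"
        using Suc.IH[of s] s p_pos p_less_1
        by (intro sum_mono mult_left_mono rate_nonneg) auto
      also have "\<dots> = exp (- \<mu> * s) * (\<Sum>y\<in>nbs x. rate p x y * h y)"
        by (simp add: sum_distrib_left mult.left_commute)
      also have "\<dots> \<le> exp (- \<mu> * s) * ((q - \<mu>) * h x)"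
        using super[OF True] by (simp add: q_def)
      finally have "exp (q * s) * (\<Sum>y\<in>nbs x. rate p x y * return_lt A n y s) \<le>
          exp (q * s) * (exp (- \<mu> * s) * ((q - \<mu>) * h x))" by simp
      also have "\<dots> = (q - \<mu>) * exp ((q - \<mu>) * s) * h x"
        by (simp add: left_diff_distrib exp_diff exp_minus field_simps)
      finally show "0 \<le> g' s" by (simp add: g'_def)
    qed fact
    moreover have "0 \<le> g 0" using h(1)[of x] h(2) by (auto simp: g_def return_lt_at_0)
    ultimately have "exp (q * t) * return_lt A (Suc n) x t \<le> exp ((q - \<mu>) * t) * h x"
      by (simp add: g_def)
    also have "\<dots> = exp (q * t) * (exp (- \<mu> * t) * h x)"
      by (simp add: left_diff_distrib exp_diff exp_minus divide_inverse)
    finally show ?thesis by simp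
  qed
qed

lemma return_lt_le_1:
  assumes "A \<subseteq> {x. reachable x}" "0 \<le> t"
  shows "return_lt A n x t \<le> 1"
proof -
  have "return_lt A n x t \<le> exp (- 0 * t) * 1"
    by (rule return_lt_le_supersolution[where h = "\<lambda>_. 1"])
      (use assms in \<open>auto simp: sum_rate_eq_qrate\<close>)
  then show ?thesis by simp
qed

end

section \<open>Reversibility\<close>

context exclusion begin

section \<open>Reversible weight, flux and stationarity\<close>

definition weight :: "config \<Rightarrow> real" where
  "weight x = (p / (1 - p)) ^ energy x"

lemma weight_pos: "0 < weight x"
  using p_pos p_less_1 by (simp add: weight_def)

lemma weight_O [simp]: "weight O_conf = 1"
  by (simp add: weight_def)

text \<open>A right jump multiplies the weight by p/(1-p), which compensates the ratio of the two
  jump rates.\<close>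

lemma detailed_balance:
  assumes "reachable x" "reachable y"
  shows "weight x * rate p x y = weight y * rate p y x"
proof -
  have *: "weight x * rate p x y = weight y * rate p y x"
    if "right_jump x y" "reachable x" "reachable y" for x y
    using that rate_right[of x y p] rate_left[of y x p] energy_right_jump[of x y] p_less_1
    by (simp add: weight_def right_jump_iff_left_jump)
  show ?thesis
  proof (cases "y \<in> nbs x")
    case True
    then show ?thesis using *[of x y] *[of y x] assms
      by (auto simp: nbs_def right_jump_iff_left_jump)
  next
    case False
    then show ?thesis using nbs_sym[of y x] by (simp add: rate_eq_0)
  qed
qed

definition outflow :: "config set \<Rightarrow> config \<Rightarrow> real" where
  "outflow A x = (\<Sum>y\<in>nbs x - A. rate p x y)"

text \<open>The rate at which the stationary chain leaves \<open>A\<close>, for the weight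
  normalised to 1 at \<open>O_conf\<close> rather than to total mass 1.\<close>

definition flux :: "config set \<Rightarrow> real" where
  "flux A = (\<Sum>x\<in>A. weight x * outflow A x)"

lemma outflow_nonneg: "0 \<le> outflow A x"
  unfolding outflow_def by (intro sum_nonneg rate_nonneg) (use p_pos p_less_1 in auto)

lemma flux_nonneg: "0 \<le> flux A"
  unfolding flux_def by (intro sum_nonneg mult_nonneg_nonneg outflow_nonneg) (simp add: less_imp_le weight_pos)

lemma sum_nbs_split:
  assumes "reachable x" "finite A"
  shows "(\<Sum>y\<in>nbs x. rate p x y * g y) = (\<Sum>y\<in>A. rate p x y * g y) + (\<Sum>y\<in>nbs x - A. rate p x y * g y)"
proof -
  have "(\<Sum>y\<in>nbs x. rate p x y * g y) =
      (\<Sum>y\<in>nbs x \<inter> A. rate p x y * g y) + (\<Sum>y\<in>nbs x - A. rate p x y * g y)"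
    using sum.Int_Diff[OF finite_nbs[OF assms(1)]] .
  also have "(\<Sum>y\<in>nbs x \<inter> A. rate p x y * g y) = (\<Sum>y\<in>A. rate p x y * g y)"
    by (rule sum.mono_neutral_left) (use assms rate_eq_0[of _ x p] in fastforce)+
  finally show ?thesis .
qed

lemma sum_rate_within:
  assumes "reachable x" "finite A"
  shows "(\<Sum>y\<in>A. rate p x y) = qrate p x - outflow A x"
  using sum_nbs_split[OF assms, of "\<lambda>_. 1"] sum_rate_eq_qrate[OF assms(1), of p]
  by (simp add: outflow_def)

lemma sum_nbs_within:
  assumes "reachable x" "finite A" "\<And>y. y \<notin> A \<Longrightarrow> g y = 0"
  shows "(\<Sum>y\<in>nbs x. rate p x y * g y) = (\<Sum>y\<in>A. rate p x y * g y)"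
  using assms by (simp add: sum_nbs_split)

lemma rate_form_sym:
  assumes "A \<subseteq> {x. reachable x}"
  shows "(\<Sum>x\<in>A. weight x * ((\<Sum>y\<in>A. rate p x y * u y) * v x)) =
    (\<Sum>x\<in>A. weight x * (u x * (\<Sum>y\<in>A. rate p x y * v y)))"
proof -
  have "(\<Sum>x\<in>A. weight x * ((\<Sum>y\<in>A. rate p x y * u y) * v x)) =
      (\<Sum>x\<in>A. \<Sum>y\<in>A. (weight x * rate p x y) * (u y * v x))"
    by (simp add: sum_distrib_left sum_distrib_right mult.assoc mult.left_commute)
  also have "\<dots> = (\<Sum>y\<in>A. \<Sum>x\<in>A. (weight x * rate p x y) * (u y * v x))" by (rule sum.swap)
  also have "\<dots> = (\<Sum>y\<in>A. \<Sum>x\<in>A. (weight y * rate p y x) * (u y * v x))"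
    by (intro sum.cong refl) (use assms detailed_balance in \<open>auto simp: subset_iff\<close>)
  also have "\<dots> = (\<Sum>x\<in>A. weight x * (u x * (\<Sum>y\<in>A. rate p x y * v y)))"
    by (simp add: sum_distrib_left mult.assoc mult.left_commute)
  finally show ?thesis .
qed

text \<open>Symmetry of the rate form tested against the constant 1: the weight is stationary up to
  the mass lost through the boundary of \<open>A\<close>.\<close>

lemma sum_weight_rate:
  assumes "finite A" "A \<subseteq> {x. reachable x}"
  shows "(\<Sum>x\<in>A. weight x * (\<Sum>y\<in>A. rate p x y * u y)) =
    (\<Sum>x\<in>A. weight x * (u x * (qrate p x - outflow A x)))"
proof -
  have "(\<Sum>x\<in>A. weight x * (\<Sum>y\<in>A. rate p x y * u y)) =
      (\<Sum>x\<in>A. weight x * (u x * (\<Sum>y\<in>A. rate p x y)))"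
    using rate_form_sym[OF assms(2), of u "\<lambda>_. 1"] by simp
  also have "\<dots> = (\<Sum>x\<in>A. weight x * (u x * (qrate p x - outflow A x)))"
    by (intro sum.cong refl) (use assms sum_rate_within in auto)
  finally show ?thesis .
qed

text \<open>Stationarity of the weight bounds the expected number of exits from \<open>A\<close>
  during \<open>[0, t]\<close> by \<open>t * flux A\<close>.\<close>

lemma exit_bound:
  assumes A: "finite A" "A \<subseteq> {x. reachable x}" "O_conf \<in> A" and "0 \<le> t"
  shows "return_lt {x. reachable x} n O_conf t - return_lt A n O_conf t \<le> t * flux A"
proof (cases n)
  case 0
  then show ?thesis using assms flux_nonneg by (simp add: return_lt_def)
next
  case (Suc m)
  define U where "U = {x. reachable x}"
  \<comment> \<open>The contribution of the paths that leave \<open>A\<close>. Its weighted sum over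
    \<open>A\<close> vanishes at time 0 and will be shown to grow at rate at most
    \<open>flux A\<close>.\<close>
  define \<Delta> where "\<Delta> = (\<lambda>n x s. return_lt U n x s - return_lt A n x s)"
  have reach: "reachable x" if "x \<in> A" for x using A that by auto
  have \<Delta>_eq: "\<Delta> n x s = (\<Sum>k<n. return_n U k x s - return_n A k x s)" for n x s
    by (simp add: \<Delta>_def return_lt_def sum_subtractf)
  have \<Delta>_term: "0 \<le> return_n U k x s - return_n A k x s" if "x \<in> A" "0 \<le> s" for k x s
    using return_n_mono[of A U x s k] A that by (auto simp: U_def)
  have \<Delta>_nonneg: "0 \<le> \<Delta> n x s" if "x \<in> A" "0 \<le> s" for n x s
    unfolding \<Delta>_eq by (intro sum_nonneg \<Delta>_term that)
  have \<Delta>_mono: "\<Delta> m x s \<le> \<Delta> (Suc m) x s" if "x \<in> A" "0 \<le> s" for x s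
    unfolding \<Delta>_eq using \<Delta>_term[OF that] by simp
  define \<Delta>' where "\<Delta>' = (\<lambda>x s. - qrate p x * \<Delta> (Suc m) x s
    + (\<Sum>y\<in>nbs x. rate p x y * return_lt U m y s) - (\<Sum>y\<in>nbs x. rate p x y * return_lt A m y s))"
  define g where "g = (\<lambda>s. s * flux A - (\<Sum>x\<in>A. weight x * \<Delta> (Suc m) x s))"
  have "g 0 \<le> g t"
  proof (rule increasing_from_0[where g' = "\<lambda>s. flux A - (\<Sum>x\<in>A. weight x * \<Delta>' x s)"])
    show "continuous_on {0..} g" unfolding g_def \<Delta>_def by (intro continuous_intros)
    fix s :: real assume s: "0 < s"
    have D: "((\<lambda>s. \<Delta> (Suc m) x s) has_real_derivative \<Delta>' x s) (at s)" if "x \<in> A" for x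
      unfolding \<Delta>_def \<Delta>'_def
      by (rule DERIV_cong[OF DERIV_diff[OF return_lt_Suc_has_derivative return_lt_Suc_has_derivative]])
        (use reach that s in \<open>auto simp: U_def algebra_simps\<close>)
    show "(g has_real_derivative flux A - (\<Sum>x\<in>A. weight x * \<Delta>' x s)) (at s)"
      unfolding g_def
      by (rule DERIV_cong[OF DERIV_diff[OF DERIV_cmult_right[OF DERIV_ident] DERIV_sum[OF DERIV_cmult[OF D]]]]) auto
    have "\<Delta>' x s \<le> - qrate p x * \<Delta> (Suc m) x s + (\<Sum>y\<in>A. rate p x y * \<Delta> m y s) + outflow A x"
      if x: "x \<in> A" for x
    proof -
      have "(\<Sum>y\<in>nbs x. rate p x y * return_lt U m y s) - (\<Sum>y\<in>nbs x. rate p x y * return_lt A m y s)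
          = (\<Sum>y\<in>nbs x. rate p x y * \<Delta> m y s)"
        by (simp add: \<Delta>_def sum_subtractf right_diff_distrib)
      also have "\<dots> = (\<Sum>y\<in>A. rate p x y * \<Delta> m y s) + (\<Sum>y\<in>nbs x - A. rate p x y * \<Delta> m y s)"
        by (rule sum_nbs_split) (use A x in auto)
      \<comment> \<open>After an exit the continuation is bounded by the trivial probability bound
        1.\<close>
      also have "(\<Sum>y\<in>nbs x - A. rate p x y * \<Delta> m y s) \<le> (\<Sum>y\<in>nbs x - A. rate p x y * 1)"
      proof (intro sum_mono mult_left_mono rate_nonneg)
        fix y assume "y \<in> nbs x - A"
        then show "\<Delta> m y s \<le> 1"
          using return_lt_le_1[of U s m y] s by (simp add: \<Delta>_def return_lt_outside U_def)
      qed (use p_pos p_less_1 in auto)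
      finally show ?thesis by (simp add: \<Delta>'_def outflow_def)
    qed
    then have "(\<Sum>x\<in>A. weight x * \<Delta>' x s) \<le>
        (\<Sum>x\<in>A. weight x * (- qrate p x * \<Delta> (Suc m) x s + (\<Sum>y\<in>A. rate p x y * \<Delta> m y s) + outflow A x))"
      by (intro sum_mono mult_left_mono) (auto simp: weight_pos less_imp_le)
    also have "\<dots> = (\<Sum>x\<in>A. weight x * (- qrate p x * \<Delta> (Suc m) x s)) +
        (\<Sum>x\<in>A. weight x * (\<Sum>y\<in>A. rate p x y * \<Delta> m y s)) + flux A"
      unfolding flux_def by (simp only: distrib_left sum.distrib)
    also have "\<dots> = (\<Sum>x\<in>A. weight x * (- qrate p x * \<Delta> (Suc m) x s) +
        weight x * (\<Delta> m x s * (qrate p x - outflow A x))) + flux A"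
      unfolding sum_weight_rate[OF A(1,2)] sum.distrib ..
    \<comment> \<open>Gain and loss differ only in the jump cap, m against m + 1; monotonicity in
      the cap makes each bracket nonpositive.\<close>
    also have "\<dots> \<le> (\<Sum>x\<in>A. 0) + flux A"
    proof (intro add_right_mono sum_mono)
      fix x assume x: "x \<in> A"
      have "\<Delta> m x s * (qrate p x - outflow A x) \<le> \<Delta> m x s * qrate p x"
        using outflow_nonneg \<Delta>_nonneg[OF x, of s m] s by (intro mult_left_mono) auto
      also have "\<dots> \<le> qrate p x * \<Delta> (Suc m) x s"
        using \<Delta>_mono[OF x, of s] s qrate_nonneg[of p x] p_pos p_less_1
        by (simp add: mult.commute mult_left_mono)
      finally have "weight x * (\<Delta> m x s * (qrate p x - outflow A x)) \<le> weight x * (qrate p x * \<Delta> (Suc m) x s)"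
        using weight_pos[of x] by simp
      then show "weight x * (- qrate p x * \<Delta> (Suc m) x s) +
        weight x * (\<Delta> m x s * (qrate p x - outflow A x)) \<le> 0" by simp
    qed
    finally show "0 \<le> flux A - (\<Sum>x\<in>A. weight x * \<Delta>' x s)" by simp
  qed fact
  moreover have "g 0 = 0"
    using A by (auto simp: g_def \<Delta>_def return_lt_at_0 U_def intro!: sum.neutral)
  ultimately have "(\<Sum>x\<in>A. weight x * \<Delta> (Suc m) x t) \<le> t * flux A" by (simp add: g_def)
  moreover have "weight O_conf * \<Delta> (Suc m) O_conf t \<le> (\<Sum>x\<in>A. weight x * \<Delta> (Suc m) x t)"
    using A weight_pos \<Delta>_nonneg assms(4) by (intro member_le_sum) (auto simp: less_imp_le)
  ultimately show ?thesis by (simp add: Suc \<Delta>_def U_def)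
qed

text \<open>The weighted mass on \<open>A\<close> starts at 1 and is lost in two ways: through the
  boundary, at rate at most \<open>flux A\<close>, and through the jump cap. Summed over caps below
  \<open>K\<close> the latter losses telescope to a rate bounded independently of \<open>K\<close>,
  so on average truncation costs only order t / \<open>K\<close>.\<close>

lemma mass_bound:
  assumes A: "finite A" "A \<subseteq> {x. reachable x}" "O_conf \<in> A" and "0 \<le> t"
  shows "real K - t * (\<Sum>x\<in>A. weight x * qrate p x) - t * (real K * flux A)
    \<le> real K * (\<Sum>x\<in>A. weight x * return_lt A K x t)"
proof -
  define C where "C = (\<Sum>x\<in>A. weight x * qrate p x)"
  define mass where "mass = (\<lambda>n s. \<Sum>x\<in>A. weight x * return_lt A n x s)"
  have reach: "reachable x" if "x \<in> A" for x using A that by auto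
  define mass' where "mass' = (\<lambda>n s. \<Sum>x\<in>A. weight x *
    (- qrate p x * return_lt A (Suc n) x s + (\<Sum>y\<in>A. rate p x y * return_lt A n y s)))"
  define g where "g = (\<lambda>s. (\<Sum>n<K. mass (Suc n) s) + s * (C + real K * flux A))"
  have "g 0 \<le> g t"
  proof (rule increasing_from_0[where g' = "\<lambda>s. (\<Sum>n<K. mass' n s) + (C + real K * flux A)"])
    show "continuous_on {0..} g" unfolding g_def mass_def by (intro continuous_intros)
    fix s :: real assume s: "0 < s"
    have D: "(mass (Suc n) has_real_derivative mass' n s) (at s)" for n
      unfolding mass_def mass'_def
    proof (intro DERIV_sum DERIV_cmult)
      fix x assume x: "x \<in> A"
      show "(return_lt A (Suc n) x has_real_derivative - qrate p x * return_lt A (Suc n) x s +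
          (\<Sum>y\<in>A. rate p x y * return_lt A n y s)) (at s)"
        using return_lt_Suc_has_derivative[OF reach[OF x] x s, of n]
          sum_nbs_within[OF reach[OF x] A(1), of "\<lambda>y. return_lt A n y s"]
        by (simp add: return_lt_outside)
    qed
    show "(g has_real_derivative (\<Sum>n<K. mass' n s) + (C + real K * flux A)) (at s)"
      unfolding g_def
      by (rule DERIV_cong[OF DERIV_add[OF DERIV_sum[OF D] DERIV_cmult_right[OF DERIV_ident]]]) auto
    have "mass' n s = - ((\<Sum>x\<in>A. weight x * qrate p x * return_lt A (Suc n) x s) -
        (\<Sum>x\<in>A. weight x * qrate p x * return_lt A n x s))
        - (\<Sum>x\<in>A. weight x * outflow A x * return_lt A n x s)" for n
      unfolding mass'_def distrib_left sum.distrib sum_weight_rate[OF A(1,2)]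
      by (simp add: sum_negf sum_subtractf algebra_simps)
    then have "(\<Sum>n<K. mass' n s) = - (\<Sum>n<K. (\<Sum>x\<in>A. weight x * qrate p x * return_lt A (Suc n) x s) -
        (\<Sum>x\<in>A. weight x * qrate p x * return_lt A n x s))
        - (\<Sum>n<K. \<Sum>x\<in>A. weight x * outflow A x * return_lt A n x s)"
      by (simp only: sum_subtractf sum_negf)
    also have "\<dots> = - (\<Sum>x\<in>A. weight x * qrate p x * return_lt A K x s)
        - (\<Sum>n<K. \<Sum>x\<in>A. weight x * outflow A x * return_lt A n x s)"
      using sum_lessThan_telescope[of "\<lambda>n. \<Sum>x\<in>A. weight x * qrate p x * return_lt A n x s" K]
      by (simp add: return_lt_def[of A 0])
    finally have eq: "(\<Sum>n<K. mass' n s) = \<dots>" .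
    have le1: "return_lt A n x s \<le> 1" for n x using return_lt_le_1[OF A(2)] s by simp
    have "(\<Sum>x\<in>A. weight x * qrate p x * return_lt A K x s) \<le> (\<Sum>x\<in>A. weight x * qrate p x * 1)"
      using weight_pos qrate_nonneg p_pos p_less_1 by (intro sum_mono mult_left_mono le1) (auto simp: less_imp_le)
    moreover have "(\<Sum>n<K. \<Sum>x\<in>A. weight x * outflow A x * return_lt A n x s) \<le>
        (\<Sum>n<K. \<Sum>x\<in>A. weight x * outflow A x * 1)"
      using weight_pos outflow_nonneg by (intro sum_mono mult_left_mono le1) (auto simp: less_imp_le)
    ultimately show "0 \<le> (\<Sum>n<K. mass' n s) + (C + real K * flux A)"
      unfolding eq by (simp add: C_def flux_def)
  qed fact
  moreover have "mass (Suc n) 0 = 1" for n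
  proof -
    have "mass (Suc n) 0 = (\<Sum>x\<in>A. if x = O_conf then 1 else 0)"
      unfolding mass_def return_lt_at_0 by (rule sum.cong) auto
    then show ?thesis using A by simp
  qed
  \<comment> \<open>Mass increases with the cap, so the average over caps is at most the mass for
    the largest one.\<close>
  moreover have "(\<Sum>n<K. mass (Suc n) t) \<le> (\<Sum>n<K. mass K t)"
  proof (rule sum_mono)
    fix n assume "n \<in> {..<K}"
    then have "return_lt A (Suc n) x t \<le> return_lt A K x t" for x
      unfolding return_lt_def by (intro sum_mono2 return_n_nonneg \<open>0 \<le> t\<close>) auto
    then show "mass (Suc n) t \<le> mass K t"
      unfolding mass_def by (intro sum_mono mult_left_mono) (auto simp: weight_pos less_imp_le)
  qed
  ultimately show ?thesis by (simp add: g_def mass_def C_def algebra_simps)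
qed

text \<open>Reversibility makes \<open>s \<mapsto> \<langle>P\<^sub>s 1\<^sub>O, P\<^sub>t\<^sub>-\<^sub>s 1\<^sub>O\<rangle>\<close> constant, sorted here by the total number of jumps.\<close>

lemma return_n_convolution:
  assumes A: "finite A" "A \<subseteq> {x. reachable x}" "O_conf \<in> A" and t: "0 \<le> s" "s \<le> t"
  shows "(\<Sum>i\<le>n. \<Sum>x\<in>A. weight x * (return_n A i x s * return_n A (n - i) x (t - s)))
    = return_n A n O_conf t"
proof -
  define f where "f = return_n A"
  \<comment> \<open>The gain term of the backward equation; it is 0 for paths without jumps.\<close>
  define R where "R = (\<lambda>n x s. case n of 0 \<Rightarrow> 0 | Suc m \<Rightarrow> \<Sum>y\<in>A. rate p x y * f m y s)"
  define I where "I = (\<lambda>s. \<Sum>i\<le>n. \<Sum>x\<in>A. weight x * (f i x s * f (n - i) x (t - s)))"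
  have reach: "reachable x" if "x \<in> A" for x using A that by auto
  have D: "(f k x has_real_derivative - qrate p x * f k x s + R k x s) (at s)"
    if x: "x \<in> A" and s: "0 < s" for k x s
  proof (cases k)
    case 0
    then show ?thesis using return_n_0_has_derivative by (simp add: f_def R_def)
  next
    case (Suc m)
    then show ?thesis
      using return_n_Suc_has_derivative[OF reach[OF x] x s, of m]
        sum_nbs_within[OF reach[OF x] A(1), of "\<lambda>y. return_n A m y s"]
      by (simp add: return_n_outside f_def R_def)
  qed
  \<comment> \<open>Shifting \<open>i\<close> by one and using symmetry of the rate form moves the
    last remaining part of the generator from one factor to the other, so the derivative in s
    vanishes.\<close>
  have cancel: "(\<Sum>i\<le>n. \<Sum>x\<in>A. weight x * (R i x s * f (n - i) x s')) =
      (\<Sum>i\<le>n. \<Sum>x\<in>A. weight x * (f i x s * R (n - i) x s'))" for s s'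
  proof (cases n)
    case 0
    then show ?thesis by (simp add: R_def)
  next
    case (Suc m)
    have "(\<Sum>i\<le>n. \<Sum>x\<in>A. weight x * (R i x s * f (n - i) x s')) =
        (\<Sum>i\<le>m. \<Sum>x\<in>A. weight x * ((\<Sum>y\<in>A. rate p x y * f i y s) * f (m - i) x s'))"
      unfolding Suc sum.atMost_Suc_shift by (simp add: R_def)
    also have "\<dots> = (\<Sum>i\<le>m. \<Sum>x\<in>A. weight x * (f i x s * (\<Sum>y\<in>A. rate p x y * f (m - i) y s')))"
      by (simp only: rate_form_sym[OF A(2)])
    also have "\<dots> = (\<Sum>i\<le>m. \<Sum>x\<in>A. weight x * (f i x s * R (Suc m - i) x s'))"
      by (intro sum.cong refl) (simp add: R_def Suc_diff_le)
    also have "\<dots> = (\<Sum>i\<le>n. \<Sum>x\<in>A. weight x * (f i x s * R (n - i) x s'))"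
      unfolding Suc by (simp add: R_def)
    finally show ?thesis .
  qed
  have DI: "(I has_real_derivative 0) (at s)" if s: "0 < s" "s < t" for s
  proof -
    have D': "((\<lambda>s. f k x (t - s)) has_real_derivative
        - (- qrate p x * f k x (t - s) + R k x (t - s))) (at s)" if "x \<in> A" for k x
    proof -
      have "((\<lambda>s. t - s) has_real_derivative - 1) (at s)" by (auto intro!: derivative_eq_intros)
      from DERIV_chain2[OF D[OF that, of "t - s" k] this] s show ?thesis by simp
    qed
    have "(I has_real_derivative (\<Sum>i\<le>n. \<Sum>x\<in>A. weight x *
        ((- qrate p x * f i x s + R i x s) * f (n - i) x (t - s) +
         - (- qrate p x * f (n - i) x (t - s) + R (n - i) x (t - s)) * f i x s))) (at s)"
      unfolding I_def by (intro DERIV_sum DERIV_cmult DERIV_mult D D' s(1))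
    also have "(\<Sum>i\<le>n. \<Sum>x\<in>A. weight x *
        ((- qrate p x * f i x s + R i x s) * f (n - i) x (t - s) +
         - (- qrate p x * f (n - i) x (t - s) + R (n - i) x (t - s)) * f i x s)) =
       (\<Sum>i\<le>n. \<Sum>x\<in>A. weight x * (R i x s * f (n - i) x (t - s)) -
         weight x * (f i x s * R (n - i) x (t - s)))"
      by (intro sum.cong refl) (simp add: algebra_simps)
    also have "\<dots> = 0" unfolding sum_subtractf using cancel[of s "t - s"] by simp
    finally show ?thesis .
  qed
  have cont: "continuous_on {0..t} I"
  proof -
    have "continuous_on {0..t} (\<lambda>s. f k x (t - s))" for k x
      by (rule continuous_on_compose2[OF return_n_continuous_on[of A k x, folded f_def]])
        (auto intro!: continuous_intros)
    moreover have "continuous_on {0..t} (f k x)" for k x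
      by (rule continuous_on_subset[OF return_n_continuous_on[of A k x, folded f_def]]) auto
    ultimately show ?thesis unfolding I_def by (intro continuous_intros)
  qed
  have "I s = I 0"
  proof (cases "s = 0")
    case False
    show ?thesis
      by (rule DERIV_isconst2[where b = t]) (use False t cont DI in auto)
  qed simp
  also have "I 0 = (\<Sum>i\<le>n. if i = 0 then f n O_conf t else 0)"
    unfolding I_def
  proof (rule sum.cong)
    fix i
    have "(\<Sum>x\<in>A. weight x * (f i x 0 * f (n - i) x (t - 0))) =
        (\<Sum>x\<in>A. if x = O_conf then of_bool (i = 0) * f (n - i) O_conf t else 0)"
      by (rule sum.cong) (use A in \<open>auto simp: f_def return_n_at_0\<close>)
    then show "(\<Sum>x\<in>A. weight x * (f i x 0 * f (n - i) x (t - 0))) = (if i = 0 then f n O_conf t else 0)"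
      using A by simp
  qed simp
  also have "\<dots> = f n O_conf t" by simp
  finally show ?thesis by (simp add: I_def f_def)
qed

text \<open>Cauchy--Schwarz in the weighted space bounds the squared mass by a quadratic form at
  time t/2. Its index pairs below \<open>K\<close> lie in the triangle i + j < 2 \<open>K\<close>,
  whose antidiagonals are return probabilities at time t by
  \<open>return_n_convolution\<close>.\<close>

lemma return_lt_ge_mass:
  assumes A: "finite A" "A \<subseteq> {x. reachable x}" "O_conf \<in> A" and "0 \<le> t"
  shows "(\<Sum>x\<in>A. weight x * return_lt A K x (t / 2))\<^sup>2 \<le>
    (\<Sum>x\<in>A. weight x) * return_lt A (2 * K) O_conf t"
proof -
  define a where "a = (\<lambda>i j. \<Sum>x\<in>A. weight x * (return_n A i x (t/2) * return_n A j x (t/2)))"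
  have a: "0 \<le> a i j" for i j
    unfolding a_def using assms weight_pos return_n_nonneg
    by (intro sum_nonneg mult_nonneg_nonneg) (auto simp: less_imp_le)
  define F where "F = (\<lambda>x. return_lt A K x (t / 2))"
  have CS: "(\<Sum>x\<in>A. weight x * F x)\<^sup>2 \<le> (\<Sum>x\<in>A. weight x) * (\<Sum>x\<in>A. weight x * (F x * F x))"
  proof -
    have "(\<Sum>x\<in>A. weight x * F x)\<^sup>2 = (\<Sum>x\<in>A. sqrt (weight x) * (sqrt (weight x) * F x))\<^sup>2"
      by (simp add: mult.assoc[symmetric] weight_pos less_imp_le)
    also have "\<dots> \<le> (\<Sum>x\<in>A. (sqrt (weight x))\<^sup>2) * (\<Sum>x\<in>A. (sqrt (weight x) * F x)\<^sup>2)"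
      by (rule Cauchy_Schwarz_ineq_sum)
    also have "\<dots> = (\<Sum>x\<in>A. weight x) * (\<Sum>x\<in>A. weight x * (F x * F x))"
      by (simp add: power_mult_distrib weight_pos less_imp_le power2_eq_square[of "F _"])
    finally show ?thesis .
  qed
  have "(\<Sum>x\<in>A. weight x * (F x * F x)) = (\<Sum>i<K. \<Sum>j<K. a i j)"
  proof -
    have "(\<Sum>x\<in>A. weight x * (F x * F x)) =
        (\<Sum>x\<in>A. \<Sum>i<K. \<Sum>j<K. weight x * (return_n A i x (t/2) * return_n A j x (t/2)))"
    proof (rule sum.cong)
      fix x
      have "F x * F x = (\<Sum>i<K. \<Sum>j<K. return_n A i x (t/2) * return_n A j x (t/2))"
        by (simp only: F_def return_lt_def sum_product)
      then show "weight x * (F x * F x) =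
          (\<Sum>i<K. \<Sum>j<K. weight x * (return_n A i x (t/2) * return_n A j x (t/2)))"
        by (simp only: sum_distrib_left)
    qed simp
    also have "\<dots> = (\<Sum>i<K. \<Sum>x\<in>A. \<Sum>j<K. weight x * (return_n A i x (t/2) * return_n A j x (t/2)))"
      by (rule sum.swap)
    also have "\<dots> = (\<Sum>i<K. \<Sum>j<K. a i j)"
      unfolding a_def by (intro sum.cong refl sum.swap)
    finally show ?thesis .
  qed
  also have "\<dots> = (\<Sum>(i,j)\<in>{..<K} \<times> {..<K}. a i j)" by (simp add: sum.cartesian_product)
  also have "\<dots> \<le> (\<Sum>(i,j)\<in>{(i,j). i + j < 2 * K}. a i j)"
  proof (rule sum_mono2)
    show "finite {(i, j). i + j < 2 * K}"
      by (rule finite_subset[of _ "{..<2*K} \<times> {..<2*K}"]) auto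
  qed (auto simp: a)
  also have "\<dots> = (\<Sum>k<2 * K. \<Sum>i\<le>k. a i (k - i))" by (rule sum.triangle_reindex)
  also have "\<dots> = return_lt A (2 * K) O_conf t"
    unfolding return_lt_def a_def
    using return_n_convolution[OF A, of "t / 2" t] assms(4) by simp
  finally have "(\<Sum>x\<in>A. weight x) * (\<Sum>x\<in>A. weight x * (F x * F x)) \<le>
      (\<Sum>x\<in>A. weight x) * return_lt A (2 * K) O_conf t"
    using weight_pos by (intro mult_left_mono) (auto simp: sum_nonneg less_imp_le)
  with CS show ?thesis unfolding F_def by (rule order_trans)
qed

end

section \<open>Quantitative bounds\<close>

lemma Mpos_move_right:
  assumes "reachable x" "i \<in> right_sites x"
  shows "Mpos (move x i 1) = (if i = Mpos x then Mpos x + 1 else Mpos x)"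
proof (rule Mpos_unique)
  show "(if i = Mpos x then Mpos x + 1 else Mpos x) \<in> move x i 1"
    using Mpos_reachable(1)[OF assms(1)] by auto
  fix j assume "j \<in> move x i 1"
  moreover have "i \<le> Mpos x" using Mpos_reachable(2)[OF assms(1)] assms(2) by (simp add: right_sites_def)
  ultimately show "j \<le> (if i = Mpos x then Mpos x + 1 else Mpos x)"
    using Mpos_reachable(2)[OF assms(1), of j] by auto
qed

lemma Mpos_move_left:
  assumes "reachable x" "i \<in> left_sites x"
  shows "Mpos (move x i (-1)) = (if i = Mpos x then Mpos x - 1 else Mpos x)"
proof (rule Mpos_unique)
  show "(if i = Mpos x then Mpos x - 1 else Mpos x) \<in> move x i (-1)"
    using Mpos_reachable(1)[OF assms(1)] by auto
  fix j assume j: "j \<in> move x i (-1)"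
  moreover have "i \<le> Mpos x" using Mpos_reachable(2)[OF assms(1)] assms(2) by (simp add: left_sites_def)
  moreover have "j \<in> x \<Longrightarrow> j \<le> Mpos x" using Mpos_reachable(2)[OF assms(1)] .
  ultimately show "j \<le> (if i = Mpos x then Mpos x - 1 else Mpos x)" by auto
qed

lemma Mpos_in_right_sites: "reachable x \<Longrightarrow> Mpos x \<in> right_sites x"
  using Mpos_reachable(1,2)[of x] by (force simp: right_sites_def)

context exclusion begin

text \<open>For the walk on the naturals with rates \<open>p\<close> up and \<open>1 - p\<close> down, reflected at \<open>0\<close>,
  \<open>step_time m\<close> is the expected time to go from \<open>m\<close> to \<open>m + 1\<close>.\<close>

primrec step_time :: "nat \<Rightarrow> real" where
  "step_time 0 = 1 / p"
| "step_time (Suc m) = (1 + (1 - p) * step_time m) / p"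

definition hit_time :: "nat \<Rightarrow> nat \<Rightarrow> real" where
  "hit_time L m = (\<Sum>j\<in>{m..<L}. step_time j)"

lemma step_time_pos: "0 < step_time m"
  using p_pos p_less_1 by (induction m) (auto intro!: divide_pos_pos add_pos_pos)

lemma hit_time_nonneg: "0 \<le> hit_time L m"
  unfolding hit_time_def by (intro sum_nonneg less_imp_le step_time_pos)

lemma hit_time_Suc: "m < L \<Longrightarrow> hit_time L m = step_time m + hit_time L (Suc m)"
  unfolding hit_time_def by (simp add: sum.atLeast_Suc_lessThan)

lemma hit_time_le_0: "hit_time L m \<le> hit_time L 0"
  unfolding hit_time_def by (intro sum_mono2) (auto intro: less_imp_le step_time_pos)

text \<open>With R = (1-p)/p at least 1, the recursion gives \<open>step_time m\<close> at most
  (m+1) R^m / p; each of the L summands is then at most L R^L / p.\<close>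

lemma hit_time_le:
  assumes "p \<le> 1 / 2"
  shows "hit_time L 0 \<le> (real L)\<^sup>2 * ((1 - p) / p) ^ L / p"
proof -
  define R where "R = (1 - p) / p"
  have R: "1 \<le> R" using assms p_pos by (simp add: R_def)
  have "step_time m \<le> (real m + 1) * R ^ m / p" for m
  proof (induction m)
    case (Suc m)
    have "step_time (Suc m) = 1 / p + R * step_time m"
      by (simp add: R_def add_divide_distrib)
    also have "\<dots> \<le> R ^ Suc m / p + R * ((real m + 1) * R ^ m / p)"
      using Suc R one_le_power[OF R, of "Suc m"] p_pos
      by (intro add_mono mult_left_mono divide_right_mono) auto
    also have "\<dots> = (real (Suc m) + 1) * R ^ Suc m / p"
      by (simp add: add_divide_distrib[symmetric] algebra_simps)
    finally show ?case .
  qed simp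
  moreover have "(real m + 1) * R ^ m / p \<le> real L * R ^ L / p" if "m < L" for m
    using that R p_pos by (intro divide_right_mono mult_mono power_increasing) auto
  ultimately have "hit_time L 0 \<le> (\<Sum>j\<in>{0..<L}. real L * R ^ L / p)"
    unfolding hit_time_def by (intro sum_mono) (meson atLeastLessThan_iff order_trans)
  then show ?thesis by (simp add: R_def power2_eq_square)
qed

text \<open>The rightmost particle always jumps right at rate \<open>p\<close> and jumps left at rate at most
  \<open>1 - p\<close>, so it dominates the reflected walk.\<close>

lemma hit_time_generator:
  assumes x: "reachable x" "Mpos x + 1 < int L"
  defines "h \<equiv> \<lambda>x. hit_time L (nat (Mpos x + 1))"
  shows "(\<Sum>y\<in>nbs x. rate p x y * h y) \<le> qrate p x * h x - 1"
proof -
  define M where "M = Mpos x"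
  \<comment> \<open>The rightmost particle never goes below -1, so M + 1 is the level of the
    reflected walk.\<close>
  define m where "m = nat (M + 1)"
  have M: "M \<ge> -1" using Mpos_reachable(3)[OF x(1)] by (simp add: M_def)
  have mL: "m < L" using x M by (simp add: m_def M_def)
  have hx: "h x = hit_time L m" by (simp add: h_def m_def M_def)
  have fin: "finite (right_sites x)" "finite (left_sites x)" using card_right_sites[OF x(1)] by auto
  have "(\<Sum>i\<in>right_sites x. h (move x i 1)) = (\<Sum>i\<in>right_sites x. h x - (if i = M then step_time m else 0))"
  proof (rule sum.cong)
    fix i assume i: "i \<in> right_sites x"
    have "nat (M + 1 + 1) = Suc m" using M by (simp add: m_def)
    then show "h (move x i 1) = h x - (if i = M then step_time m else 0)"
      unfolding h_def Mpos_move_right[OF x(1) i] M_def[symmetric]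
      using hit_time_Suc[OF mL] by (simp add: m_def)
  qed simp
  then have right: "(\<Sum>i\<in>right_sites x. h (move x i 1)) = real (card (right_sites x)) * h x - step_time m"
    using Mpos_in_right_sites[OF x(1)] fin by (simp add: sum_subtractf M_def)
  \<comment> \<open>The increase of the hitting time when the rightmost particle steps left; at
    level 0 that step is impossible.\<close>
  define e where "e = (if m = 0 then 0 else step_time (m - 1))"
  have e: "0 \<le> e" by (simp add: e_def less_imp_le step_time_pos)
  have "(\<Sum>i\<in>left_sites x. h (move x i (-1))) \<le> (\<Sum>i\<in>left_sites x. h x + (if i = M then e else 0))"
  proof (rule sum_mono)
    fix i assume i: "i \<in> left_sites x"
    show "h (move x i (-1)) \<le> h x + (if i = M then e else 0)"
    proof (cases "i = M")
      case True
      have "left_jump x (move x i (-1))" using i by (auto simp: left_jump_def left_sites_def)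
      then have "Mpos (move x i (-1)) \<ge> -1" using x(1) Mpos_reachable(3) reachable_left by blast
      then have "M \<ge> 0" using Mpos_move_left[OF x(1) i] True by (simp add: M_def)
      then obtain k where k: "m = Suc k" "M = int k"
        by (metis Suc_as_int m_def zero_le_imp_eq_int nat_int)
      have "h (move x i (-1)) = hit_time L k"
        using Mpos_move_left[OF x(1) i] True k by (simp add: h_def M_def)
      then show ?thesis using hit_time_Suc[of k L] mL k True by (simp add: hx e_def)
    next
      case False
      then show ?thesis using Mpos_move_left[OF x(1) i] by (simp add: h_def M_def)
    qed
  qed
  also have "\<dots> \<le> real (card (left_sites x)) * h x + e"
    using fin e by (simp add: sum.distrib)
  finally have left: "(\<Sum>i\<in>left_sites x. h (move x i (-1))) \<le> real (card (left_sites x)) * h x + e" .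
  have "(\<Sum>y\<in>nbs x. rate p x y * h y) \<le>
      p * (real (card (right_sites x)) * h x - step_time m) + (1 - p) * (real (card (left_sites x)) * h x + e)"
    unfolding sum_rate[OF x(1)] right using left p_less_1 by simp
  also have "\<dots> = qrate p x * h x - (p * step_time m - (1 - p) * e)"
    by (simp add: qrate_eq algebra_simps)
  \<comment> \<open>This identity is the recursion defining \<open>step_time\<close>.\<close>
  also have "p * step_time m - (1 - p) * e = 1"
    using p_pos by (cases m) (auto simp: e_def)
  finally show ?thesis .
qed

text \<open>Divided by its value T at level 0, the hitting time is at most 1. Its drift of at most
  -1/T is therefore at most -1/T times the function itself, which makes it a supersolution with
  decay rate 1/T.\<close>

lemma rightmost_stays_low_bound:
  assumes "1 \<le> L" "0 \<le> t"
  shows "return_lt {x. reachable x \<and> Mpos x + 1 < int L} n O_conf t \<le> exp (- t / hit_time L 0)"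
proof -
  define h where "h = (\<lambda>x. hit_time L (nat (Mpos x + 1)) / hit_time L 0)"
  have pos: "0 < hit_time L 0"
    using hit_time_Suc[of 0 L] assms step_time_pos[of 0] hit_time_nonneg[of L "Suc 0"] by linarith
  have hO: "h O_conf = 1" using pos by (simp add: h_def Mpos_O)
  have "return_lt {x. reachable x \<and> Mpos x + 1 < int L} n O_conf t \<le>
      exp (- (1 / hit_time L 0) * t) * h O_conf"
  proof (rule return_lt_le_supersolution)
    fix x assume "x \<in> {x. reachable x \<and> Mpos x + 1 < int L}"
    then have x: "reachable x" "Mpos x + 1 < int L" by auto
    have "(\<Sum>y\<in>nbs x. rate p x y * h y) =
        (\<Sum>y\<in>nbs x. rate p x y * hit_time L (nat (Mpos y + 1))) / hit_time L 0"
      by (simp add: h_def sum_divide_distrib)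
    also have "\<dots> \<le> (qrate p x * hit_time L (nat (Mpos x + 1)) - 1) / hit_time L 0"
      using hit_time_generator[OF x] pos by (simp add: divide_right_mono)
    also have "\<dots> = qrate p x * h x - 1 / hit_time L 0" by (simp add: h_def diff_divide_distrib)
    also have "\<dots> \<le> qrate p x * h x - 1 / hit_time L 0 * h x"
      using mult_left_mono[of "h x" 1 "1 / hit_time L 0"] hit_time_le_0[of L] pos
      by (simp add: h_def)
    finally show "(\<Sum>y\<in>nbs x. rate p x y * h y) \<le> (qrate p x - 1 / hit_time L 0) * h x"
      by (simp add: left_diff_distrib)
  qed (use hO pos assms hit_time_nonneg in \<open>auto simp: h_def\<close>)
  then show ?thesis by (simp add: hO)
qed

section \<open>Exits from energy balls and the return probability\<close>

definition energy_ball :: "nat \<Rightarrow> config set" where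
  "energy_ball N = {x. reachable x \<and> energy x \<le> N}"

lemma energy_ball_facts: "finite (energy_ball N)" "energy_ball N \<subseteq> {x. reachable x}" "O_conf \<in> energy_ball N"
  using finite_energy_le reachable_O by (auto simp: energy_ball_def)

text \<open>Only states of energy exactly \<open>N\<close> can leave, and their exit rate is linear
  in \<open>N\<close>. Spending a factor \<open>r ^ N\<close> on the uniform generating function
  bound replaces counting the states of energy \<open>N\<close>.\<close>

lemma flux_energy_ball_le:
  assumes "0 < r" "r < 1"
  shows "flux (energy_ball N) \<le> (2 * real N + 2) * (p / (1 - p) / r) ^ N * exp (2 / (1 - r))"
proof -
  define r0 where "r0 = p / (1 - p)"
  have r0: "0 < r0" using p_pos p_less_1 by (simp add: r0_def)
  have "weight x * outflow (energy_ball N) x \<le> (2 * real N + 2) * (r0 / r) ^ N * r ^ energy x"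
    if x: "x \<in> energy_ball N" for x
  proof (cases "energy x < N")
    case True
    have "y \<in> energy_ball N" if "y \<in> nbs x" for y
      using that x True reachable_nbs[of x y] energy_right_jump[of x y] energy_left_jump[of x y]
      by (auto simp: energy_ball_def nbs_def)
    then have "nbs x - energy_ball N = {}" by blast
    then show ?thesis using r0 assms unfolding outflow_def by (simp only:) simp
  next
    case False
    then have E: "energy x = N" "reachable x" using x by (auto simp: energy_ball_def)
    have "outflow (energy_ball N) x \<le> (\<Sum>y\<in>nbs x. rate p x y)"
      unfolding outflow_def using finite_nbs[OF E(2)] rate_nonneg p_pos p_less_1
      by (intro sum_mono2) auto
    also have "\<dots> = qrate p x" using sum_rate_eq_qrate[OF E(2)] .
    also have "\<dots> \<le> p * (2 * real N + 2) + (1 - p) * (2 * real N + 2)"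
      unfolding qrate_eq using card_right_sites(3,4)[OF E(2)] E(1) p_pos p_less_1
      by (intro add_mono mult_left_mono) auto
    finally have "outflow (energy_ball N) x \<le> 2 * real N + 2" by (simp add: algebra_simps)
    then have "weight x * outflow (energy_ball N) x \<le> weight x * (2 * real N + 2)"
      using weight_pos[of x] by simp
    also have "\<dots> = (2 * real N + 2) * (r0 / r) ^ N * r ^ energy x"
    proof -
      have "(r0 / r) ^ N * r ^ N = r0 ^ N" using assms by (simp add: power_mult_distrib[symmetric])
      then show ?thesis using E by (simp add: weight_def r0_def[symmetric] mult.assoc)
    qed
    finally show ?thesis .
  qed
  then have "flux (energy_ball N) \<le> (\<Sum>x\<in>energy_ball N. (2 * real N + 2) * (r0 / r) ^ N * r ^ energy x)"
    unfolding flux_def by (rule sum_mono)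
  also have "\<dots> = (2 * real N + 2) * (r0 / r) ^ N * (\<Sum>x\<in>energy_ball N. r ^ energy x)"
    by (simp add: sum_distrib_left)
  also have "\<dots> \<le> (2 * real N + 2) * (r0 / r) ^ N * exp (2 / (1 - r))"
    using sum_pow_energy_le[OF assms energy_ball_facts(1)] r0 assms
    by (intro mult_left_mono) (auto simp: energy_ball_def)
  finally show ?thesis by (simp add: r0_def)
qed

text \<open>At time t/2 at most 1/4 of the mass is lost to exits and at most 1/4 to truncation. The
  remaining 1/2 is squared by Cauchy--Schwarz, which explains the 4; the exponential bounds the
  total weight.\<close>

lemma return_prob_lower_bound:
  assumes "p < 1 / 2" "0 \<le> t" "t * flux (energy_ball N) \<le> 1 / 2"
  shows "\<exists>n. 1 / (4 * exp (2 / (1 - p / (1 - p)))) \<le> return_lt (energy_ball N) n O_conf t"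
proof -
  define W where "W = exp (2 / (1 - p / (1 - p)))"
  define C where "C = (\<Sum>x\<in>energy_ball N. weight x * qrate p x)"
  \<comment> \<open>This size makes the truncation loss over time t/2 at most a quarter; the
    successor below ensures positivity.\<close>
  obtain K0 where K0: "2 * t * C \<le> real K0" using real_arch_simple by blast
  define K where "K = Suc K0"
  have K: "2 * t * C \<le> real K" "0 < real K" using K0 by (auto simp: K_def)
  define mass where "mass = (\<Sum>x\<in>energy_ball N. weight x * return_lt (energy_ball N) K x (t / 2))"
  have "real K - t / 2 * C - t / 2 * (real K * flux (energy_ball N)) \<le> real K * mass"
    unfolding C_def mass_def by (rule mass_bound[OF energy_ball_facts]) (use assms in simp)
  moreover have "t / 2 * (real K * flux (energy_ball N)) \<le> real K * (1 / 4)"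
    using mult_left_mono[OF assms(3), of "real K / 2"] by (simp add: algebra_simps)
  ultimately have "real K * (1 / 2) \<le> real K * mass" using K by linarith
  then have "1 / 2 \<le> mass" using K by simp
  then have "(1 / 2)\<^sup>2 \<le> mass\<^sup>2" by (intro power_mono) auto
  also have "\<dots> \<le> (\<Sum>x\<in>energy_ball N. weight x) * return_lt (energy_ball N) (2 * K) O_conf t"
    unfolding mass_def by (rule return_lt_ge_mass[OF energy_ball_facts assms(2)])
  also have "\<dots> \<le> W * return_lt (energy_ball N) (2 * K) O_conf t"
    unfolding W_def weight_def
    using sum_pow_energy_le[of "p / (1 - p)" "energy_ball N"] energy_ball_facts(1,2)[of N] assms p_pos
    by (intro mult_right_mono return_lt_nonneg) auto
  finally have "1 / (4 * W) \<le> return_lt (energy_ball N) (2 * K) O_conf t"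
    by (simp add: W_def field_simps power2_eq_square)
  then show ?thesis unfolding W_def by blast
qed

section \<open>From truncated sums to the conditional probability\<close>

lemma return_lt_eq_sum:
  "return_lt A n O_conf t = (\<Sum>xs\<in>(\<Union>k<n. paths_in A k O_conf). path_prob p xs t)"
  unfolding return_lt_def return_n_def
  by (rule sum.UNION_disjoint[symmetric])
    (use finite_paths_in[OF reachable_O] in \<open>auto simp: paths_in_iff\<close>)

lemma finite_subset_paths_O_O:
  assumes "finite S" "S \<subseteq> paths_O_O"
  shows "\<exists>n. S \<subseteq> (\<Union>k<n. paths_in {x. reachable x} k O_conf)"
proof -
  define n where "n = Suc (Max (insert 0 (length ` S)))"
  have "xs \<in> (\<Union>k<n. paths_in {x. reachable x} k O_conf)" if xs: "xs \<in> S" for xs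
  proof -
    obtain k where k: "xs \<in> paths_in {x. reachable x} k O_conf"
      using assms xs unfolding paths_O_O_eq by blast
    then have "Suc k = length xs" by (simp add: paths_in_iff)
    also have "\<dots> < n" using assms xs by (simp add: n_def le_imp_less_Suc)
    finally show ?thesis using k by auto
  qed
  then show ?thesis by blast
qed

text \<open>A bad path either leaves the energy ball or keeps its rightmost particle low. Both
  estimates concern paths returning to \<open>O_conf\<close>, so their sum is divided by the lower
  bound on the return probability. Finite sums suffice, because finitely many paths have bounded
  length.\<close>

lemma cond_prob_O_bounds:
  assumes p: "p < 1 / 2" and t: "0 \<le> t" "t * flux (energy_ball N) \<le> 1 / 2" and L: "1 \<le> L"
    and Ev: "\<And>xs. xs \<in> paths_O_O \<Longrightarrow> \<not> Ev xs \<Longrightarrow>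
      \<not> set xs \<subseteq> energy_ball N \<or> set xs \<subseteq> {x. reachable x \<and> Mpos x + 1 < int L}"
  shows "cond_prob_O p Ev t \<le> 1"
    "1 - 4 * exp (2 / (1 - p / (1 - p))) * (t * flux (energy_ball N) + exp (- t / hit_time L 0))
      \<le> cond_prob_O p Ev t"
proof -
  define U where "U = {x. reachable x}"
  define B where "B = {x. reachable x \<and> Mpos x + 1 < int L}"
  define f where "f = (\<lambda>xs. path_prob p xs t)"
  define W where "W = 4 * exp (2 / (1 - p / (1 - p)))"
  have f_nonneg: "0 \<le> f xs" for xs
    unfolding f_def using path_prob_nonneg p_pos p_less_1 t by simp
  define Pn where "Pn = (\<lambda>A n. \<Union>k<n. paths_in A k O_conf)"
  have finP: "finite (Pn A n)" for A n
    using finite_paths_in[OF reachable_O] by (auto simp: Pn_def)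
  have sumP: "sum f (Pn A n) = return_lt A n O_conf t" for A n
    by (simp add: return_lt_eq_sum Pn_def f_def)
  \<comment> \<open>Confined paths form a subfamily, so differences of return probabilities measure
    the paths that leave \<open>A\<close>.\<close>
  have PnU: "Pn A n = {xs \<in> Pn U n. set xs \<subseteq> A}" if "A \<subseteq> U" for A n
    unfolding Pn_def paths_in_iff set_eq_iff using that by (auto simp: paths_in_iff)
  have "f summable_on paths_O_O"
  proof (rule nonneg_bdd_above_summable_on)
    show "bdd_above (sum f ` {F. F \<subseteq> paths_O_O \<and> finite F})"
    proof (rule bdd_aboveI2)
      fix F assume "F \<in> {F. F \<subseteq> paths_O_O \<and> finite F}"
      then obtain n where "F \<subseteq> Pn U n"
        using finite_subset_paths_O_O[of F] by (auto simp: Pn_def U_def)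
      then have "sum f F \<le> sum f (Pn U n)" using finP f_nonneg by (intro sum_mono2) auto
      also have "\<dots> \<le> 1" unfolding sumP using return_lt_le_1 t by (simp add: U_def)
      finally show "sum f F \<le> 1" .
    qed
  qed (rule f_nonneg)
  then have summ: "f summable_on S" if "S \<subseteq> paths_O_O" for S
    using summable_on_subset_banach that by blast
  define Z where "Z = infsum f paths_O_O"
  define G where "G = infsum f {xs \<in> paths_O_O. Ev xs}"
  define Bad where "Bad = infsum f {xs \<in> paths_O_O. \<not> Ev xs}"
  have "paths_O_O = {xs \<in> paths_O_O. Ev xs} \<union> {xs \<in> paths_O_O. \<not> Ev xs}" by blast
  then have ZGB: "Z = G + Bad" unfolding Z_def G_def Bad_def
    by (subst (1) \<open>paths_O_O = _\<close>, intro infsum_Un_disjoint summ) auto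
  have "0 \<le> G" "0 \<le> Bad" unfolding G_def Bad_def by (intro infsum_nonneg f_nonneg)+
  have "Bad \<le> t * flux (energy_ball N) + exp (- t / hit_time L 0)"
    unfolding Bad_def
  proof (rule infsum_le_finite_sums)
    show "f summable_on {xs \<in> paths_O_O. \<not> Ev xs}" by (rule summ) auto
    fix F assume F: "finite F" "F \<subseteq> {xs \<in> paths_O_O. \<not> Ev xs}"
    then obtain n where n: "F \<subseteq> Pn U n"
      using finite_subset_paths_O_O[of F] by (auto simp: Pn_def U_def)
    have "F \<subseteq> (Pn U n - Pn (energy_ball N) n) \<union> Pn B n"
    proof
      fix xs assume xs: "xs \<in> F"
      then have "\<not> set xs \<subseteq> energy_ball N \<or> set xs \<subseteq> B" using Ev F(2) unfolding B_def by blast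
      moreover have "energy_ball N \<subseteq> U" "B \<subseteq> U" by (auto simp: energy_ball_def U_def B_def)
      ultimately show "xs \<in> (Pn U n - Pn (energy_ball N) n) \<union> Pn B n"
        using PnU[of B n] PnU[of "energy_ball N" n] n xs by blast
    qed
    then have "sum f F \<le> sum f ((Pn U n - Pn (energy_ball N) n) \<union> Pn B n)"
      using finP f_nonneg by (intro sum_mono2) auto
    also have "\<dots> \<le> sum f (Pn U n - Pn (energy_ball N) n) + sum f (Pn B n)"
      using sum.union_inter[of "Pn U n - Pn (energy_ball N) n" "Pn B n" f] finP
        sum_nonneg[of "(Pn U n - Pn (energy_ball N) n) \<inter> Pn B n" f] f_nonneg by simp
    also have "sum f (Pn U n - Pn (energy_ball N) n) = return_lt U n O_conf t - return_lt (energy_ball N) n O_conf t"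
    proof -
      have "Pn (energy_ball N) n \<subseteq> Pn U n"
        using PnU[of "energy_ball N" n] energy_ball_facts(2)[of N] unfolding U_def by blast
      then show ?thesis by (simp add: sum_diff[OF finP] sumP)
    qed
    also have "\<dots> \<le> t * flux (energy_ball N)" unfolding U_def by (rule exit_bound[OF energy_ball_facts t(1)])
    also have "sum f (Pn B n) \<le> exp (- t / hit_time L 0)"
      unfolding sumP B_def by (rule rightmost_stays_low_bound[OF L t(1)])
    finally show "sum f F \<le> t * flux (energy_ball N) + exp (- t / hit_time L 0)" by simp
  qed
  moreover obtain n where n: "1 / W \<le> return_lt (energy_ball N) n O_conf t"
    using return_prob_lower_bound[OF p t] by (auto simp: W_def)
  have "1 / W \<le> Z"
  proof -
    have "Pn (energy_ball N) n \<subseteq> paths_O_O"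
      using PnU[of "energy_ball N" n] energy_ball_facts(2)[of N] by (auto simp: paths_O_O_eq Pn_def U_def)
    then have "sum f (Pn (energy_ball N) n) \<le> Z"
      unfolding Z_def using summ finP f_nonneg by (intro finite_sum_le_infsum) auto
    then show ?thesis using n by (simp add: sumP)
  qed
  moreover have W: "0 < W" by (simp add: W_def)
  ultimately have Z: "0 < Z" and "1 \<le> W * Z"
    by (auto simp: field_simps intro: less_le_trans[of 0 "1 / W"])
  have cond: "cond_prob_O p Ev t = G / Z"
    by (simp add: cond_prob_O_def G_def Z_def f_def)
  show "cond_prob_O p Ev t \<le> 1" unfolding cond using Z ZGB \<open>0 \<le> Bad\<close> by simp
  have "Bad / Z \<le> Bad * W"
    using \<open>1 \<le> W * Z\<close> \<open>0 \<le> Bad\<close> Z mult_left_mono[of 1 "W * Z" Bad] by (simp add: field_simps)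
  also have "\<dots> \<le> (t * flux (energy_ball N) + exp (- t / hit_time L 0)) * W"
    using \<open>Bad \<le> _\<close> W by simp
  finally show "1 - 4 * exp (2 / (1 - p / (1 - p))) * (t * flux (energy_ball N) + exp (- t / hit_time L 0))
      \<le> cond_prob_O p Ev t"
    unfolding cond using Z ZGB by (simp add: W_def field_simps)
qed

end

text \<open>For paths from \<open>O_conf\<close> to itself the energy factor is 1, and the
  exponential common to all of them cancels in the ratio.\<close>

lemma cond_prob_O_swap:
  assumes "0 < p" "p < 1" "0 \<le> t"
  shows "cond_prob_O p Ev t = cond_prob_O (1 - p) Ev t"
proof -
  have "path_prob p xs t = exp (- (2 * p - 1) * t) * path_prob (1 - p) xs t"
    if "xs \<in> paths_O_O" for xs
    using path_prob_swap[OF assms(1,2), of xs t] that reachable_O assms(3)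
    by (auto simp: paths_O_O_def)
  then have "infsum (\<lambda>xs. path_prob p xs t) S =
      exp (- (2 * p - 1) * t) * infsum (\<lambda>xs. path_prob (1 - p) xs t) S" if "S \<subseteq> paths_O_O" for S
    using that by (subst infsum_cmult_right'[symmetric], intro infsum_cong) auto
  from this[of paths_O_O] this[of "{xs \<in> paths_O_O. Ev xs}"]
  show ?thesis by (simp add: cond_prob_O_def)
qed

section \<open>Asymptotics\<close>

text \<open>Logarithmic cutoffs turn the errors into powers of t: the exit term is at most of order
  t^(-\<epsilon>/2) ln t, and the hitting time at most of order t^(1-\<delta>) (ln t)^2, which is
  negligible against t.\<close>

lemma cond_prob_O_tendsto_subcritical:
  fixes p \<epsilon> :: real
  assumes p: "0 < p" "p < 1 / 2" and "\<epsilon> > 0"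
  defines "c \<equiv> 1 / ln ((1 - p) / p)"
  shows "((\<lambda>t. cond_prob_O p
            (\<lambda>xs. (1 - \<epsilon>) * c * ln t \<le> real_of_int (Max (Mpos ` set xs))
                 \<and> Max (Mpos ` set xs) \<le> Max (Dist ` set xs)
                 \<and> real_of_int (Max (Dist ` set xs)) \<le> (1 + \<epsilon>) * c * ln t) t)
          \<longlongrightarrow> 1) at_top"
proof -
  interpret exclusion p using p by unfold_locales auto
  define R where "R = (1 - p) / p"
  have R: "1 < R" using p by (simp add: R_def)
  have lnR: "0 < ln R" using R by simp
  have c: "0 < c" "c * ln R = 1" using lnR by (simp_all add: c_def R_def[symmetric])
  \<comment> \<open>Capping \<delta> below 1 keeps the lower cutoff nonnegative even for large
    \<epsilon>.\<close>
  define \<delta> where "\<delta> = min \<epsilon> (1 / 2)"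
  have \<delta>: "0 < \<delta>" "\<delta> < 1" "\<delta> \<le> \<epsilon>" using \<open>\<epsilon> > 0\<close> by (auto simp: \<delta>_def)
  \<comment> \<open>Chosen so that giving up the fraction \<eta> of the exponent turns 1 +
    \<epsilon> into 1 + \<epsilon>/2.\<close>
  define \<eta> where "\<eta> = \<epsilon> / (2 * (1 + \<epsilon>))"
  have \<eta>: "0 < \<eta>" "\<eta> < 1" "(1 - \<eta>) * (1 + \<epsilon>) = 1 + \<epsilon> / 2"
    using \<open>\<epsilon> > 0\<close> by (simp_all add: \<eta>_def field_simps)
  \<comment> \<open>Here r = R^(-\<eta>), so p/(1-p) divided by r is R^(-(1-\<eta>)).\<close>
  define r where "r = exp (- \<eta> * ln R)"
  have r: "0 < r" "r < 1" using \<eta> lnR by (auto simp: r_def)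
  define N where "N = (\<lambda>t. nat \<lfloor>(1 + \<epsilon>) * c * ln t\<rfloor>)"
  \<comment> \<open>The added 1 makes M + 1 \<ge> L imply M \<ge> (1-\<delta>) c ln t; it also gives
    L \<ge> 1.\<close>
  define L where "L = (\<lambda>t. nat \<lceil>(1 - \<delta>) * c * ln t\<rceil> + 1)"
  define g1 where "g1 = (\<lambda>t. R * exp (2 / (1 - r)) * ((2 * ((1 + \<epsilon>) * c * ln t) + 2) * t powr (- \<epsilon> / 2)))"
  define g2 where "g2 = (\<lambda>t. exp (- (p / R\<^sup>2) * (t powr \<delta> / (c * ln t + 2)\<^sup>2)))"
  define W where "W = 4 * exp (2 / (1 - p / (1 - p)))"
  have g1_lim: "(g1 \<longlongrightarrow> 0) at_top"
  proof -
    have "((\<lambda>t. (2 * ((1 + \<epsilon>) * c * ln t) + 2) * t powr (- \<epsilon> / 2)) \<longlongrightarrow> 0) at_top"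
      using \<open>\<epsilon> > 0\<close> c by real_asymp
    from tendsto_mult_right_zero[OF this] show ?thesis by (simp add: g1_def)
  qed
  have g2_lim: "(g2 \<longlongrightarrow> 0) at_top"
  proof -
    have "filterlim (\<lambda>t. t powr \<delta> / (c * ln t + 2)\<^sup>2) at_top at_top"
      using \<delta> c by real_asymp
    moreover have "0 < p / R\<^sup>2" using p R by simp
    ultimately have "filterlim (\<lambda>t. - (p / R\<^sup>2) * (t powr \<delta> / (c * ln t + 2)\<^sup>2)) at_bot at_top"
      by (intro filterlim_tendsto_neg_mult_at_bot[OF tendsto_const]) auto
    then show ?thesis unfolding g2_def by (rule filterlim_compose[OF exp_at_bot])
  qed
  have flux_le: "t * flux (energy_ball (N t)) \<le> g1 t" if t: "1 \<le> t" for t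
  proof -
    define a where "a = (1 + \<epsilon>) * c * ln t"
    have a: "0 \<le> a" using t c \<open>\<epsilon> > 0\<close> by (simp add: a_def)
    have N: "real (N t) \<le> a" "a - 1 \<le> real (N t)"
      using a unfolding N_def a_def[symmetric] by linarith+
    have "p / (1 - p) / r = exp (- (1 - \<eta>) * ln R)"
    proof -
      have "p / (1 - p) = exp (- ln R)" using R by (simp add: exp_minus R_def)
      then show ?thesis by (simp add: r_def exp_diff[symmetric] algebra_simps)
    qed
    then have "(p / (1 - p) / r) ^ N t = exp (- (1 - \<eta>) * ln R * real (N t))"
      by (simp add: exp_of_nat2_mult[symmetric])
    \<comment> \<open>Rounding down in \<open>N\<close> costs at most one factor R, absorbed in
      \<open>g1\<close>.\<close>
    also have "\<dots> \<le> exp (- (1 - \<eta>) * ln R * (a - 1))"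
      using N(2) \<eta> lnR by (simp add: mult_left_mono)
    also have "- (1 - \<eta>) * ln R * (a - 1) = (1 - \<eta>) * ln R - (1 + \<epsilon> / 2) * ln t"
    proof -
      have "- (1 - \<eta>) * ln R * (a - 1) = (1 - \<eta>) * ln R - ((1 - \<eta>) * (1 + \<epsilon>)) * (c * ln R) * ln t"
        by (simp add: a_def algebra_simps)
      then show ?thesis by (simp add: \<eta> c)
    qed
    also have "exp \<dots> \<le> exp (ln R - (1 + \<epsilon> / 2) * ln t)"
      using \<eta> lnR by (simp add: algebra_simps)
    also have "\<dots> = R * (t powr (- \<epsilon> / 2) / t)"
    proof -
      have "ln R - (1 + \<epsilon> / 2) * ln t = ln R + (- \<epsilon> / 2 * ln t - ln t)" by (simp add: algebra_simps)
      then have "exp (ln R - (1 + \<epsilon> / 2) * ln t) = exp (ln R) * (exp (- \<epsilon> / 2 * ln t) / exp (ln t))"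
        by (simp only: exp_add exp_diff)
      then show ?thesis using t R by (simp add: powr_def)
    qed
    finally have pow: "(p / (1 - p) / r) ^ N t \<le> R * (t powr (- \<epsilon> / 2) / t)" .
    have "flux (energy_ball (N t)) \<le> (2 * real (N t) + 2) * (p / (1 - p) / r) ^ N t * exp (2 / (1 - r))"
      by (rule flux_energy_ball_le[OF r])
    also have "\<dots> \<le> (2 * a + 2) * (R * (t powr (- \<epsilon> / 2) / t)) * exp (2 / (1 - r))"
      using N(1) pow p r a by (intro mult_right_mono mult_mono) auto
    finally have "t * flux (energy_ball (N t)) \<le> t * ((2 * a + 2) * (R * (t powr (- \<epsilon> / 2) / t)) * exp (2 / (1 - r)))"
      using t by (intro mult_left_mono) auto
    also have "\<dots> = g1 t" using t by (simp add: g1_def a_def)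
    finally show ?thesis .
  qed
  have hit_le: "exp (- t / hit_time (L t) 0) \<le> g2 t" if t: "1 \<le> t" for t
  proof -
    define b where "b = (1 - \<delta>) * c * ln t"
    have b: "0 \<le> b" "b \<le> c * ln t" using t c \<delta> by (auto simp: b_def mult_left_le_one_le)
    have L: "real (L t) \<le> b + 2" using b unfolding L_def b_def[symmetric] by linarith
    have "R ^ L t = exp (ln R * real (L t))" using R by (simp add: exp_of_nat2_mult)
    also have "\<dots> \<le> exp (ln R * (b + 2))" using L lnR by simp
    also have "ln R * (b + 2) = (1 - \<delta>) * (c * ln R) * ln t + (ln R + ln R)"
      by (simp add: b_def algebra_simps)
    also have "exp \<dots> = t powr (1 - \<delta>) * R\<^sup>2"
      using t R c by (simp add: exp_add powr_def exp_double)
    finally have RL: "R ^ L t \<le> t powr (1 - \<delta>) * R\<^sup>2" .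
    have "hit_time (L t) 0 \<le> (real (L t))\<^sup>2 * R ^ L t / p"
      using hit_time_le[of "L t"] p by (simp add: R_def)
    also have "\<dots> \<le> (c * ln t + 2)\<^sup>2 * (t powr (1 - \<delta>) * R\<^sup>2) / p"
      using L b RL R p by (intro divide_right_mono mult_mono power_mono) auto
    finally have H: "hit_time (L t) 0 \<le> (c * ln t + 2)\<^sup>2 * (t powr (1 - \<delta>) * R\<^sup>2) / p" .
    have Hpos: "0 < hit_time (L t) 0"
      using hit_time_Suc[of 0 "L t"] step_time_pos[of 0] hit_time_nonneg[of "L t" "Suc 0"]
      by (simp add: L_def add_pos_nonneg)
    have "p / R\<^sup>2 * (t powr \<delta> / (c * ln t + 2)\<^sup>2) = t / ((c * ln t + 2)\<^sup>2 * (t powr (1 - \<delta>) * R\<^sup>2) / p)"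
      using t p R b by (simp add: powr_diff field_simps)
    also have "\<dots> \<le> t / hit_time (L t) 0"
      using H Hpos t by (intro frac_le) auto
    finally show ?thesis by (simp add: g2_def)
  qed
  define Ev where "Ev = (\<lambda>t xs. (1 - \<epsilon>) * c * ln t \<le> real_of_int (Max (Mpos ` set xs))
                 \<and> Max (Mpos ` set xs) \<le> Max (Dist ` set xs)
                 \<and> real_of_int (Max (Dist ` set xs)) \<le> (1 + \<epsilon>) * c * ln t)"
  have bad: "\<not> set xs \<subseteq> energy_ball (N t) \<or> set xs \<subseteq> {x. reachable x \<and> Mpos x + 1 < int (L t)}"
    if xs: "xs \<in> paths_O_O" and nE: "\<not> Ev t xs" and t: "1 \<le> t" for xs t
  proof (rule ccontr)
    assume "\<not> ?thesis"
    then have ball: "set xs \<subseteq> energy_ball (N t)"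
      and nlow: "\<not> set xs \<subseteq> {x. reachable x \<and> Mpos x + 1 < int (L t)}" by auto
    have ne: "set xs \<noteq> {}" using xs by (auto simp: paths_O_O_def)
    have reach: "reachable x" if "x \<in> set xs" for x using ball that by (auto simp: energy_ball_def)
    obtain z where z: "z \<in> set xs" "int (L t) \<le> Mpos z + 1" using nlow reach by fastforce
    have "(1 - \<epsilon>) * c * ln t \<le> (1 - \<delta>) * c * ln t"
      using \<delta> c t by (intro mult_right_mono) auto
    also have "\<dots> \<le> real (L t) - 1" unfolding L_def by linarith
    also have "\<dots> \<le> Mpos z" using z(2) by linarith
    also have "Mpos z \<le> Max (Mpos ` set xs)" using z by simp
    finally have 1: "(1 - \<epsilon>) * c * ln t \<le> Max (Mpos ` set xs)" by simp
    have 2: "Max (Mpos ` set xs) \<le> Max (Dist ` set xs)"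
    proof (rule Max.boundedI)
      fix m assume "m \<in> Mpos ` set xs"
      then obtain x where x: "x \<in> set xs" "m = Mpos x" by auto
      then have "m \<le> Dist x" using Mpos_reachable(4) Dist_eq_energy reach by simp
      also have "\<dots> \<le> Max (Dist ` set xs)" using x by simp
      finally show "m \<le> Max (Dist ` set xs)" .
    qed (use ne in auto)
    have "Max (Dist ` set xs) \<le> int (N t)"
      by (rule Max.boundedI) (use ne ball reach in \<open>auto simp: Dist_eq_energy energy_ball_def\<close>)
    moreover have "real (N t) \<le> (1 + \<epsilon>) * c * ln t"
      using t c \<open>\<epsilon> > 0\<close> unfolding N_def by (simp add: of_nat_nat)
    ultimately have 3: "Max (Dist ` set xs) \<le> (1 + \<epsilon>) * c * ln t" by linarith
    from 1 2 3 nE show False by (simp add: Ev_def)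
  qed
  \<comment> \<open>The bound 1/2 on \<open>g1\<close> secures the flux condition of
    \<open>cond_prob_O_bounds\<close>.\<close>
  have ev: "\<forall>\<^sub>F t in at_top. 1 \<le> t \<and> g1 t < 1 / 2"
    using eventually_conj[OF eventually_ge_at_top[of 1] order_tendstoD(2)[OF g1_lim, of "1 / 2"]] by simp
  have "((\<lambda>t. cond_prob_O p (Ev t) t) \<longlongrightarrow> 1) at_top"
  proof (rule tendsto_sandwich)
    show "((\<lambda>t. 1 - W * (g1 t + g2 t)) \<longlongrightarrow> 1) at_top"
      using tendsto_diff[OF tendsto_const tendsto_mult_right_zero[OF tendsto_add_zero[OF g1_lim g2_lim]], of 1 W]
      by simp
    show "((\<lambda>t. 1) \<longlongrightarrow> (1::real)) at_top" by simp
    show "\<forall>\<^sub>F t in at_top. 1 - W * (g1 t + g2 t) \<le> cond_prob_O p (Ev t) t"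
      using ev
    proof eventually_elim
      case (elim t)
      then have "t * flux (energy_ball (N t)) \<le> 1 / 2" using flux_le[of t] by linarith
      then have "1 - W * (t * flux (energy_ball (N t)) + exp (- t / hit_time (L t) 0)) \<le> cond_prob_O p (Ev t) t"
        unfolding W_def by (intro cond_prob_O_bounds(2)[where N = "N t" and L = "L t"])
          (use p elim bad in \<open>auto simp: L_def\<close>)
      moreover have "W * (t * flux (energy_ball (N t)) + exp (- t / hit_time (L t) 0)) \<le> W * (g1 t + g2 t)"
        using flux_le[of t] hit_le[of t] elim by (intro mult_left_mono add_mono) (auto simp: W_def)
      ultimately show ?case by linarith
    qed
    show "\<forall>\<^sub>F t in at_top. cond_prob_O p (Ev t) t \<le> 1"
      using ev
    proof eventually_elim
      case (elim t)
      then have "t * flux (energy_ball (N t)) \<le> 1 / 2" using flux_le[of t] by linarith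
      then show ?case
        by (intro cond_prob_O_bounds(1)[where N = "N t" and L = "L t"])
          (use p elim bad in \<open>auto simp: L_def\<close>)
    qed
  qed
  then show ?thesis by (simp add: Ev_def)
qed

theorem theorem4p2:
  fixes p :: real and \<epsilon> :: real
  assumes "0 < p" "p < 1" "p \<noteq> 1/2" "\<epsilon> > 0"
  defines "c \<equiv> 1 / \<bar>ln ((1 - p) / p)\<bar>"
  shows "((\<lambda>t. cond_prob_O p
            (\<lambda>xs. (1 - \<epsilon>) * c * ln t \<le> real_of_int (Max (Mpos ` set xs))
                 \<and> Max (Mpos ` set xs) \<le> Max (Dist ` set xs)
                 \<and> real_of_int (Max (Dist ` set xs)) \<le> (1 + \<epsilon>) * c * ln t) t)
          \<longlongrightarrow> 1) at_top"
proof (cases "p < 1 / 2")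
  case True
  then have "c = 1 / ln ((1 - p) / p)" using assms by (simp add: c_def)
  then show ?thesis using cond_prob_O_tendsto_subcritical[OF assms(1) True assms(4)] by simp
next
  case False
  then have q: "0 < 1 - p" "1 - p < 1 / 2" using assms by auto
  \<comment> \<open>The logarithm changes sign when p and 1 - p are exchanged, so c is the same for
    both parameters.\<close>
  have "ln ((1 - p) / p) = - ln (p / (1 - p))" using assms by (simp add: ln_div)
  moreover have "0 < ln (p / (1 - p))" using q assms by simp
  ultimately have c: "c = 1 / ln ((1 - (1 - p)) / (1 - p))" by (simp add: c_def)
  have "\<forall>\<^sub>F t in at_top. cond_prob_O (1 - p) (Ev t) t = cond_prob_O p (Ev t) t" for Ev
    using eventually_ge_at_top[of 0]
    by eventually_elim (use cond_prob_O_swap[OF assms(1,2)] in simp)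
  from Lim_transform_eventually[OF cond_prob_O_tendsto_subcritical[OF q assms(4), folded c] this]
  show ?thesis .
qed

end
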